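(* Let $X\in C^4(B,\mathbb R^4)$ be a conformally parametrized immersion, let $\{\widetilde N_1,\widetilde N_2\}$ be a given orthonormal normal section of $X$ with torsion coefficients $\widetilde T_{1,1}^2,\widetilde T_{1,2}^2$, and let $\varphi\in C^3(B,\mathbb R)$. Let $\{N_1,N_2\}$ be the orthonormal normal section determined by $$\widetilde N_1=\cos\varphi\,N_1+\sin\varphi\,N_2,\qquad \widetilde N_2=-\sin\varphi\,N_1+\cos\varphi\,N_2 .$$ Then $\{N_1,N_2\}$ is critical for the total torsion $\mathcal T_X$ if and only if $$\Delta\varphi=\operatorname{div}(\widetilde T_{1,1}^2,\widetilde T_{1,2}^2)\ \text{ in } B,\qquad \frac{\partial\varphi}{\partial\nu}=(\widetilde T_{1,1}^2,\widetilde T_{1,2}^2)\cdot\nu\ \text{ on }\partial B,$$ where $\nu$ is the outer unit normal to $\partial B$.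
   Context: $B=\{(u,v)\in\mathbb R^2: u^2+v^2\le 1\}$ is the closed unit disc and $\partial B$ the unit circle. A conformally parametrized immersion is a map $X\in C^4(B,\mathbb R^4)$ with $|X_u|^2=|X_v|^2=:W>0$ and $X_u\cdot X_v=0$ in $B$. An orthonormal normal section of $X$ is a pair $N_1,N_2\in C^3(B,\mathbb R^4)$ with $X_u\cdot N_\sigma=X_v\cdot N_\sigma=0$, $|N_1|=|N_2|=1$, $N_1\cdot N_2=0$ in $B$. The torsion coefficients of a section $\{N_1,N_2\}$ are $T_{1,1}^2:=N_{1,u}\cdot N_2$, $T_{1,2}^2:=N_{1,v}\cdot N_2$ (subscripts $u,v$ denote partial derivatives); those of $\{\widetilde N_1,\widetilde N_2\}$ are defined in the same way and denoted $\widetilde T_{1,1}^2,\widetilde T_{1,2}^2$. $\operatorname{div}(a,b)=a_u+b_v$. Total torsion: $\mathcal T_X(N_1,N_2):=2\iint_B\{(T_{1,1}^2)^2+(T_{1,2}^2)^2\}\,du\,dv$. The section $\{N_1,N_2\}$ is critical for $\mathcal T_X$ if for every $\chi\in C^3(B,\mathbb R)$ the function $t\mapsto\mathcal T_X(\cos(t\chi)N_1+\sin(t\chi)N_2,\,-\sin(t\chi)N_1+\cos(t\chi)N_2)$ has vanishing derivative at $t=0$. *)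

theory Defs
  imports "HOL-Analysis.Analysis"
begin

abbreviation disc :: "(real \<times> real) set"
  where "disc \<equiv> cball 0 1"

text \<open>
  Derivatives of a function on the closed disc are Frechet derivatives relative to the disc.
  Since the disc is convex with non-empty interior they are unique, and they depend only on the
  values of the function on the disc. In the interior they are the usual derivatives; on the unit
  circle they are the continuous extensions of the interior ones whenever those exist, so
  \<open>C_on_disc k\<close> is the usual class $C^k$ up to the boundary.
\<close>

definition deriv_u :: "(real \<times> real \<Rightarrow> 'a::real_normed_vector) \<Rightarrow> real \<times> real \<Rightarrow> 'a"
  where "deriv_u f p = frechet_derivative f (at p within disc) (1, 0)"

definition deriv_v :: "(real \<times> real \<Rightarrow> 'a::real_normed_vector) \<Rightarrow> real \<times> real \<Rightarrow> 'a"
  where "deriv_v f p = frechet_derivative f (at p within disc) (0, 1)"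

fun C_on_disc :: "nat \<Rightarrow> (real \<times> real \<Rightarrow> 'a::real_normed_vector) \<Rightarrow> bool" where
  "C_on_disc 0 f \<longleftrightarrow> continuous_on disc f"
| "C_on_disc (Suc k) f \<longleftrightarrow>
     f differentiable_on disc \<and> C_on_disc k (deriv_u f) \<and> C_on_disc k (deriv_v f)"

definition divergence :: "(real \<times> real \<Rightarrow> real) \<Rightarrow> (real \<times> real \<Rightarrow> real) \<Rightarrow> real \<times> real \<Rightarrow> real"
  where "divergence a b p = deriv_u a p + deriv_v b p"

definition laplacian :: "(real \<times> real \<Rightarrow> real) \<Rightarrow> real \<times> real \<Rightarrow> real"
  where "laplacian f p = deriv_u (deriv_u f) p + deriv_v (deriv_v f) p"

text \<open>On the unit circle the outer unit normal at a point is its position vector.\<close>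

definition outer_normal :: "real \<times> real \<Rightarrow> real \<times> real"
  where "outer_normal p = p"

definition normal_deriv :: "(real \<times> real \<Rightarrow> real) \<Rightarrow> real \<times> real \<Rightarrow> real"
  where "normal_deriv f p = frechet_derivative f (at p within disc) (outer_normal p)"

definition conformal_immersion :: "(real \<times> real \<Rightarrow> real ^ 4) \<Rightarrow> bool"
  where "conformal_immersion X \<longleftrightarrow>
    C_on_disc 4 X \<and>
    (\<forall>p\<in>disc. (norm (deriv_u X p))\<^sup>2 = (norm (deriv_v X p))\<^sup>2 \<and>
              (norm (deriv_u X p))\<^sup>2 > 0 \<and>
              deriv_u X p \<bullet> deriv_v X p = 0)"

definition orthonormal_normal_section ::
    "(real \<times> real \<Rightarrow> real ^ 4) \<Rightarrow> (real \<times> real \<Rightarrow> real ^ 4) \<Rightarrow> (real \<times> real \<Rightarrow> real ^ 4) \<Rightarrow> bool"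
  where "orthonormal_normal_section X N1 N2 \<longleftrightarrow>
    C_on_disc 3 N1 \<and> C_on_disc 3 N2 \<and>
    (\<forall>p\<in>disc. deriv_u X p \<bullet> N1 p = 0 \<and> deriv_v X p \<bullet> N1 p = 0 \<and>
              deriv_u X p \<bullet> N2 p = 0 \<and> deriv_v X p \<bullet> N2 p = 0 \<and>
              norm (N1 p) = 1 \<and> norm (N2 p) = 1 \<and> N1 p \<bullet> N2 p = 0)"

definition torsion_u ::
    "(real \<times> real \<Rightarrow> real ^ 4) \<Rightarrow> (real \<times> real \<Rightarrow> real ^ 4) \<Rightarrow> real \<times> real \<Rightarrow> real"
  where "torsion_u N1 N2 p = deriv_u N1 p \<bullet> N2 p"

definition torsion_v ::
    "(real \<times> real \<Rightarrow> real ^ 4) \<Rightarrow> (real \<times> real \<Rightarrow> real ^ 4) \<Rightarrow> real \<times> real \<Rightarrow> real"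
  where "torsion_v N1 N2 p = deriv_v N1 p \<bullet> N2 p"

definition total_torsion ::
    "(real \<times> real \<Rightarrow> real ^ 4) \<Rightarrow> (real \<times> real \<Rightarrow> real ^ 4) \<Rightarrow> real"
  where "total_torsion N1 N2 =
    2 * integral disc (\<lambda>p. (torsion_u N1 N2 p)\<^sup>2 + (torsion_v N1 N2 p)\<^sup>2)"

definition rotated_N1 ::
    "(real \<times> real \<Rightarrow> real) \<Rightarrow> (real \<times> real \<Rightarrow> real ^ 4) \<Rightarrow> (real \<times> real \<Rightarrow> real ^ 4)
      \<Rightarrow> real \<times> real \<Rightarrow> real ^ 4"
  where "rotated_N1 \<phi> N1 N2 p = cos (\<phi> p) *\<^sub>R N1 p + sin (\<phi> p) *\<^sub>R N2 p"

definition rotated_N2 ::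
    "(real \<times> real \<Rightarrow> real) \<Rightarrow> (real \<times> real \<Rightarrow> real ^ 4) \<Rightarrow> (real \<times> real \<Rightarrow> real ^ 4)
      \<Rightarrow> real \<times> real \<Rightarrow> real ^ 4"
  where "rotated_N2 \<phi> N1 N2 p = - sin (\<phi> p) *\<^sub>R N1 p + cos (\<phi> p) *\<^sub>R N2 p"

definition critical_section ::
    "(real \<times> real \<Rightarrow> real ^ 4) \<Rightarrow> (real \<times> real \<Rightarrow> real ^ 4) \<Rightarrow> (real \<times> real \<Rightarrow> real ^ 4) \<Rightarrow> bool"
  where "critical_section X N1 N2 \<longleftrightarrow>
    orthonormal_normal_section X N1 N2 \<and>
    (\<forall>chi. C_on_disc 3 chi \<longrightarrow>
      ((\<lambda>t. total_torsion (rotated_N1 (\<lambda>p. t * chi p) N1 N2) (rotated_N2 (\<lambda>p. t * chi p) N1 N2))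
        has_real_derivative 0) (at 0))"

end

theory Submission imports Defs begin

text \<open>
  Rotating a frame by an angle \<open>\<alpha>\<close> adds the gradient of \<open>\<alpha>\<close> to its torsion field \<open>T\<close>. Hence the total
  torsion is quadratic in \<open>t\<close> along \<open>t \<chi>\<close>, and \<open>{N1, N2}\<close> is critical iff the integral of
  \<open>T \<bullet> grad \<chi>\<close> vanishes for all \<open>\<chi>\<close>, i.e. iff \<open>T\<close> is a weak solution of \<open>div T = 0\<close> with zero normal
  component. As \<open>T\<close> is the given torsion field minus \<open>grad \<phi>\<close>, this is the Neumann problem.

  The weak and strong forms are equivalent by the divergence theorem on the disc. For fields vanishing on
  the circle that theorem is Fubini plus the fundamental theorem of calculus on chords. Boundary integrals
  are avoided by the factor \<open>1 - \<bar>p\<bar>^(2 n + 2)\<close>, which vanishes on the circle, tends to 1 inside, and whose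
  gradient tests the normal component in a thin shell.
\<close>

section \<open>Differentiability on the closed disc\<close>

text \<open>\<open>frechet_derivative\<close> is a choice operator, so the partial derivatives mean
  something only once derivatives relative to the disc are unique, also on the circle. The
  difference \<open>D\<close> of two candidates is a derivative of the zero map. Along the segment
  from \<open>p\<close> to a point \<open>y\<close> of the disc this gives
  \<open>D (y - p) = 0\<close>. The choice \<open>y = 0\<close> gives \<open>D p = 0\<close>, so
  \<open>D\<close> vanishes on the disc and by scaling everywhere.\<close>

lemma has_derivative_within_disc_unique:
  fixes f :: "real \<times> real \<Rightarrow> 'a::real_normed_vector"
  assumes "(f has_derivative A) (at p within disc)"
    and "(f has_derivative B) (at p within disc)"
    and p: "p \<in> disc"
  shows "A = B"
proof -
  define D where "D = (\<lambda>h. A h - B h)"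
  have "((\<lambda>x. f x - f x) has_derivative (\<lambda>h. A h - B h)) (at p within disc)"
    by (intro has_derivative_diff assms)
  then have D: "((\<lambda>_. 0) has_derivative D) (at p within disc)"
    by (simp add: D_def)
  then interpret linear D
    by (rule has_derivative_linear)
  have tangent: "D (y - p) = 0" if y: "y \<in> disc" for y
  proof -
    have "(\<lambda>t. p + t *\<^sub>R (y - p)) ` {0..1} \<subseteq> disc"
    proof (rule image_subsetI)
      fix t :: real assume "t \<in> {0..1}"
      then have "(1 - t) *\<^sub>R p + t *\<^sub>R y \<in> disc"
        using y p by (intro convexD_alt[OF convex_cball]) auto
      then show "p + t *\<^sub>R (y - p) \<in> disc"
        by (simp add: algebra_simps)
    qed
    moreover have "((\<lambda>t. p + t *\<^sub>R (y - p)) has_derivative (\<lambda>t. t *\<^sub>R (y - p))) (at 0 within {0..1})"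
      by (auto intro!: derivative_eq_intros)
    moreover have "((\<lambda>_. 0) has_derivative D) (at (p + 0 *\<^sub>R (y - p)) within (\<lambda>t. p + t *\<^sub>R (y - p)) ` {0..1})"
      using calculation(1) D by (auto intro: has_derivative_subset)
    ultimately have "((\<lambda>_::real. 0) has_derivative (\<lambda>t. D (t *\<^sub>R (y - p)))) (at 0 within {0..1})"
      using has_derivative_in_compose[where f = "\<lambda>t. p + t *\<^sub>R (y - p)" and g = "\<lambda>_. 0"] by blast
    then have "((\<lambda>_::real. 0) has_vector_derivative D (y - p)) (at 0 within {0..1})"
      by (simp add: has_vector_derivative_def scale)
    then show ?thesis
      using vector_derivative_unique_within_closed_interval[of 0 1 0 "\<lambda>_. 0" "D (y - p)" 0]
      by simp
  qed
  have "D p = 0"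
    using tangent[of 0] by (simp add: neg)
  then have disc0: "D y = 0" if "y \<in> disc" for y
    using tangent[OF that] by (simp add: diff)
  have "D h = 0" for h
  proof (cases "h = 0")
    case False
    have "D (h /\<^sub>R norm h) = 0"
      using False by (intro disc0) simp
    then show ?thesis using False by (simp add: scale)
  qed (simp add: zero)
  then show ?thesis
    by (simp add: D_def fun_eq_iff)
qed

lemma frechet_derivative_disc_eq:
  assumes "(f has_derivative f') (at p within disc)" "p \<in> disc"
  shows "frechet_derivative f (at p within disc) = f'"
  using has_derivative_within_disc_unique[OF _ assms]
    frechet_derivative_works[THEN iffD1, OF differentiableI, OF assms(1)] by blast

lemma deriv_disc_eq:
  assumes "(f has_derivative f') (at p within disc)" "p \<in> disc"
  shows "deriv_u f p = f' (1, 0)" "deriv_v f p = f' (0, 1)"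
  by (simp_all add: deriv_u_def deriv_v_def frechet_derivative_disc_eq[OF assms])

text \<open>This normal form lets each differentiation rule yield both partials, by evaluating its
  derivative at \<open>(1, 0)\<close> and \<open>(0, 1)\<close>.\<close>

lemma differentiable_has_derivative_disc:
  fixes f :: "real \<times> real \<Rightarrow> 'a::real_normed_vector"
  assumes "f differentiable_on disc" "p \<in> disc"
  shows "(f has_derivative (\<lambda>h. fst h *\<^sub>R deriv_u f p + snd h *\<^sub>R deriv_v f p)) (at p within disc)"
proof -
  have f: "(f has_derivative frechet_derivative f (at p within disc)) (at p within disc)"
    using assms by (auto simp: differentiable_on_def frechet_derivative_works)
  interpret linear "frechet_derivative f (at p within disc)"
    using f by (rule has_derivative_linear)
  have "frechet_derivative f (at p within disc) h = fst h *\<^sub>R deriv_u f p + snd h *\<^sub>R deriv_v f p" for h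
  proof -
    have "h = fst h *\<^sub>R (1, 0) + snd h *\<^sub>R (0, 1)"
      by (simp add: prod_eq_iff)
    then show ?thesis
      unfolding deriv_u_def deriv_v_def by (metis add scale)
  qed
  then have "frechet_derivative f (at p within disc) = (\<lambda>h. fst h *\<^sub>R deriv_u f p + snd h *\<^sub>R deriv_v f p)" ..
  then show ?thesis
    using f by (simp only:)
qed

lemma normal_deriv_eq:
  assumes "f differentiable_on disc" "p \<in> disc"
  shows "normal_deriv f p = fst p * deriv_u f p + snd p * deriv_v f p"
  unfolding normal_deriv_def outer_normal_def
  by (subst frechet_derivative_disc_eq[OF differentiable_has_derivative_disc[OF assms] assms(2)]) simp

lemma deriv_disc_cong:
  fixes f g :: "real \<times> real \<Rightarrow> 'a::real_normed_vector"
  assumes "\<And>p. p \<in> disc \<Longrightarrow> f p = g p" "p \<in> disc"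
  shows "deriv_u f p = deriv_u g p" "deriv_v f p = deriv_v g p"
proof -
  have "(f has_derivative D) (at p within disc) \<longleftrightarrow> (g has_derivative D) (at p within disc)" for D
    using has_derivative_transform[of p disc g f D] has_derivative_transform[of p disc f g D] assms by auto
  then show "deriv_u f p = deriv_u g p" "deriv_v f p = deriv_v g p"
    by (simp_all add: deriv_u_def deriv_v_def frechet_derivative_def)
qed

section \<open>Calculus of the classes C^k on the closed disc\<close>

lemma C_on_disc_cong:
  fixes f g :: "real \<times> real \<Rightarrow> 'a::real_normed_vector"
  assumes "\<And>p. p \<in> disc \<Longrightarrow> f p = g p"
  shows "C_on_disc k f \<longleftrightarrow> C_on_disc k g"
  using assms
proof (induction k arbitrary: f g)
  case 0
  then show ?case by (simp only: C_on_disc.simps cong: continuous_on_cong)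
next
  case (Suc k)
  have "C_on_disc k (deriv_u f) \<longleftrightarrow> C_on_disc k (deriv_u g)"
       "C_on_disc k (deriv_v f) \<longleftrightarrow> C_on_disc k (deriv_v g)"
    using deriv_disc_cong[of f g] Suc.prems by (auto intro!: Suc.IH)
  moreover have "f differentiable_on disc \<longleftrightarrow> g differentiable_on disc"
    using Suc.prems has_derivative_transform[of _ disc g f] has_derivative_transform[of _ disc f g]
    unfolding differentiable_on_def differentiable_def by metis
  ultimately show ?case by simp
qed

lemma C_on_disc_differentiable: "C_on_disc k f \<Longrightarrow> 0 < k \<Longrightarrow> f differentiable_on disc"
  by (cases k) auto

lemma C_on_disc_continuous: "C_on_disc k f \<Longrightarrow> continuous_on disc f"
  by (cases k) (auto intro: differentiable_imp_continuous_on)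

lemma C_on_disc_mono: "C_on_disc k f \<Longrightarrow> j \<le> k \<Longrightarrow> C_on_disc j f"
proof (induction k arbitrary: j f)
  case (Suc k)
  show ?case
    using Suc C_on_disc_continuous[OF Suc.prems(1)] by (cases j) auto
qed auto

text \<open>Trades \<open>deriv_u\<close> and \<open>deriv_v\<close> for any explicit derivative, so
  that the closure properties of the classes follow by induction from the ordinary differentiation
  rules.\<close>

lemma C_on_disc_SucI:
  fixes f :: "real \<times> real \<Rightarrow> 'a::real_normed_vector"
  assumes f: "\<And>p. p \<in> disc \<Longrightarrow> (f has_derivative f' p) (at p within disc)"
    and "C_on_disc k (\<lambda>p. f' p (1, 0))" "C_on_disc k (\<lambda>p. f' p (0, 1))"
  shows "C_on_disc (Suc k) f"
proof -
  have "C_on_disc k (deriv_u f)" "C_on_disc k (deriv_v f)"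
    using assms(2,3) deriv_disc_eq[OF f]
      C_on_disc_cong[of "deriv_u f" "\<lambda>p. f' p (1, 0)" k]
      C_on_disc_cong[of "deriv_v f" "\<lambda>p. f' p (0, 1)" k]
    by blast+
  moreover have "f differentiable_on disc"
    using f unfolding differentiable_on_def differentiable_def by blast
  ultimately show ?thesis by simp
qed

lemma C_on_disc_const: "C_on_disc k (\<lambda>_. c)"
proof (induction k arbitrary: c)
  case (Suc k)
  show ?case by (rule C_on_disc_SucI[OF has_derivative_const]) (rule Suc)+
qed simp

lemma C_on_disc_bounded_linear:
  fixes f :: "real \<times> real \<Rightarrow> 'a::real_normed_vector" and h :: "'a \<Rightarrow> 'b::real_normed_vector"
  assumes "bounded_linear h" "C_on_disc k f"
  shows "C_on_disc k (\<lambda>p. h (f p))"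
  using assms(2)
proof (induction k arbitrary: f)
  case 0
  then show ?case by (simp add: bounded_linear.continuous_on[OF assms(1)])
next
  case (Suc k)
  show ?case
    by (rule C_on_disc_SucI[OF bounded_linear.has_derivative[OF assms(1)
          differentiable_has_derivative_disc]])
       (use Suc in simp_all)
qed

lemma C_on_disc_add:
  "C_on_disc k f \<Longrightarrow> C_on_disc k g \<Longrightarrow> C_on_disc k (\<lambda>p. f p + g p)"
proof (induction k arbitrary: f g)
  case (Suc k)
  show ?case
    by (rule C_on_disc_SucI[OF has_derivative_add[OF differentiable_has_derivative_disc
          differentiable_has_derivative_disc]])
       (use Suc in simp_all)
qed (simp add: continuous_on_add)

text \<open>One induction serves products, scalar multiples and inner products. The product rule
  pairs each factor with a derivative of the other, so both factors vary in the induction.\<close>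

lemma C_on_disc_bounded_bilinear:
  fixes f :: "real \<times> real \<Rightarrow> 'a::real_normed_vector" and g :: "real \<times> real \<Rightarrow> 'b::real_normed_vector"
    and prod :: "'a \<Rightarrow> 'b \<Rightarrow> 'c::real_normed_vector"
  assumes "bounded_bilinear prod" "C_on_disc k f" "C_on_disc k g"
  shows "C_on_disc k (\<lambda>p. prod (f p) (g p))"
  using assms(2,3)
proof (induction k arbitrary: f g)
  case 0
  then show ?case by (simp add: bounded_bilinear.continuous_on[OF assms(1)])
next
  case (Suc k)
  have "C_on_disc k f" "C_on_disc k g"
    using Suc.prems by (metis C_on_disc_mono le_SucI order_refl)+
  then show ?case
    by (intro C_on_disc_SucI[OF bounded_bilinear.FDERIV[OF assms(1) differentiable_has_derivative_disc
          differentiable_has_derivative_disc]])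
       (use Suc in \<open>simp_all add: C_on_disc_add\<close>)
qed

lemmas C_on_disc_mult = C_on_disc_bounded_bilinear[OF bounded_bilinear_mult]
lemmas C_on_disc_scaleR = C_on_disc_bounded_bilinear[OF bounded_bilinear_scaleR]
lemmas C_on_disc_inner = C_on_disc_bounded_bilinear[OF bounded_bilinear_inner]

lemma C_on_disc_minus: "C_on_disc k f \<Longrightarrow> C_on_disc k (\<lambda>p. - f p)"
  by (rule C_on_disc_bounded_linear[OF bounded_linear_minus[OF bounded_linear_ident]])

lemma C_on_disc_diff: "C_on_disc k f \<Longrightarrow> C_on_disc k g \<Longrightarrow> C_on_disc k (\<lambda>p. f p - g p)"
  using C_on_disc_add[OF _ C_on_disc_minus, of k f g] by simp

lemma C_on_disc_fst_snd: "C_on_disc k fst" "C_on_disc k snd"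
proof -
  show "C_on_disc k fst"
  proof (cases k)
    case (Suc j)
    show ?thesis
      unfolding Suc
      by (rule C_on_disc_SucI[OF has_derivative_fst[OF has_derivative_ident]]) (simp_all add: C_on_disc_const)
  qed (simp add: continuous_on_fst)
  show "C_on_disc k snd"
  proof (cases k)
    case (Suc j)
    show ?thesis
      unfolding Suc
      by (rule C_on_disc_SucI[OF has_derivative_snd[OF has_derivative_ident]]) (simp_all add: C_on_disc_const)
  qed (simp add: continuous_on_snd)
qed

text \<open>Sine and cosine go through one induction because each occurs in the derivative of the
  other.\<close>

lemma C_on_disc_sin_cos:
  assumes "C_on_disc k f"
  shows "C_on_disc k (\<lambda>p. sin (f p)) \<and> C_on_disc k (\<lambda>p. cos (f p :: real))"
  using assms
proof (induction k arbitrary: f)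
  case (Suc k)
  have *: "C_on_disc k (\<lambda>p. sin (f p))" "C_on_disc k (\<lambda>p. - sin (f p))" "C_on_disc k (\<lambda>p. cos (f p))"
    using Suc.IH[of f] C_on_disc_mono[OF Suc.prems] C_on_disc_minus[of k "\<lambda>p. sin (f p)"] by auto
  have f: "(f has_derivative (\<lambda>h. fst h *\<^sub>R deriv_u f p + snd h *\<^sub>R deriv_v f p)) (at p within disc)"
    if "p \<in> disc" for p
    using Suc.prems by (intro differentiable_has_derivative_disc[OF _ that]) simp
  show ?case
    using Suc.prems C_on_disc_mult[OF *(2)] C_on_disc_mult[OF *(3)]
    by (intro conjI C_on_disc_SucI[OF has_derivative_sin[OF f]] C_on_disc_SucI[OF has_derivative_cos[OF f]])
       (simp_all add: mult.commute)
qed (simp add: continuous_intros)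

lemmas C_on_disc_sin = C_on_disc_sin_cos[THEN conjunct1]
lemmas C_on_disc_cos = C_on_disc_sin_cos[THEN conjunct2]

text \<open>Only \<open>x = 0\<close> is delicate: there the difference quotient is
  \<open>max 0 y ^ (k + 1)\<close>, which tends to 0. An exponent of at least 2 is what makes this
  work.\<close>

lemma has_real_derivative_positive_part_power:
  "((\<lambda>x. max 0 x ^ (k + 2)) has_real_derivative real (k + 2) * max 0 x ^ (k + 1)) (at x)"
proof -
  consider "x < 0" | "x > 0" | "x = 0" by linarith
  then show ?thesis
  proof cases
    case 1
    then have "\<forall>\<^sub>F y in nhds x. max 0 y ^ (k + 2) = 0"
      by (auto intro!: eventually_mono[OF order_tendstoD(2)[OF filterlim_ident 1]])
    from DERIV_cong_ev[OF refl this refl, THEN iffD2] show ?thesis using 1 by simp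
  next
    case 2
    then have "\<forall>\<^sub>F y in nhds x. max 0 y ^ (k + 2) = y ^ (k + 2)"
      by (auto intro!: eventually_mono[OF order_tendstoD(1)[OF filterlim_ident 2]])
    moreover have "((\<lambda>y. y ^ (k + 2)) has_real_derivative real (k + 2) * x ^ (k + 1)) (at x)"
      using DERIV_pow[of "k + 2" x] by simp
    ultimately show ?thesis using 2 DERIV_cong_ev[OF refl _ refl, THEN iffD2] by simp
  next
    case 3
    have "((\<lambda>y::real. max 0 y ^ (k + 1)) \<longlongrightarrow> max 0 0 ^ (k + 1)) (at 0)"
      by (intro tendsto_intros)
    moreover have "\<forall>\<^sub>F y::real in at 0. max 0 y ^ (k + 1) = max 0 y ^ (k + 2) / y"
      by (auto simp: eventually_at max_def intro!: exI[of _ 1])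
    ultimately have "((\<lambda>y::real. max 0 y ^ (k + 2) / y) \<longlongrightarrow> max 0 0 ^ (k + 1)) (at 0)"
      by (rule Lim_transform_eventually)
    then show ?thesis
      using 3 by (simp add: has_field_derivative_iff)
  qed
qed

text \<open>Supplies cutoffs with explicit support: a fourth power of a positive part is regular
  enough to serve as a C^3 test function.\<close>

lemma C_on_disc_positive_part_power:
  assumes "C_on_disc k f"
  shows "C_on_disc k (\<lambda>p. max 0 (f p :: real) ^ (k + 1))"
  using assms
proof (induction k)
  case (Suc k)
  have D: "((\<lambda>p. max 0 (f p) ^ (k + 2)) has_derivative
     (\<lambda>h. (real (k + 2) * max 0 (f p) ^ (k + 1)) *\<^sub>R (fst h *\<^sub>R deriv_u f p + snd h *\<^sub>R deriv_v f p))) (at p within disc)"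
    if "p \<in> disc" for p
    unfolding real_scaleR_def[of "real (k + 2) * _"]
    by (rule has_derivative_compose[of f _ p disc, OF differentiable_has_derivative_disc[of f, OF _ that]
        has_real_derivative_positive_part_power[of k "f p", unfolded has_field_derivative_def]])
      (use Suc.prems in simp)
  have m: "C_on_disc k (\<lambda>p. real (k + 2) * max 0 (f p) ^ (k + 1))"
    using Suc.IH C_on_disc_mono[OF Suc.prems, of k]
    by (intro C_on_disc_mult C_on_disc_const) simp_all
  have "C_on_disc (Suc k) (\<lambda>p. max 0 (f p) ^ (k + 2))"
    by (rule C_on_disc_SucI[OF D]) (use C_on_disc_mult[OF m] Suc.prems in auto)
  then show ?case by simp
qed (simp add: continuous_intros)

section \<open>The divergence theorem\<close>

text \<open>Passing to a Lebesgue integral over the whole plane makes Fubini available.\<close>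

lemma integral_lborel_disc:
  fixes f :: "real \<times> real \<Rightarrow> real"
  assumes "continuous_on disc f"
  shows "integrable lborel (\<lambda>p. indicator disc p * f p)"
    and "f integrable_on disc"
    and "integral disc f = (LINT p|lborel. indicator disc p * f p)"
proof -
  show i: "integrable lborel (\<lambda>p. indicator disc p * f p)"
    using borel_integrable_compact[OF compact_cball assms] by simp
  then have "set_integrable lborel disc f"
    by (simp add: set_integrable_def)
  from set_borel_integral_eq_integral[OF this]
  show "f integrable_on disc" "integral disc f = (LINT p|lborel. indicator disc p * f p)"
    by (simp_all add: set_lebesgue_integral_def)
qed

lemma mem_disc_iff: "(u, v) \<in> disc \<longleftrightarrow> u\<^sup>2 + v\<^sup>2 \<le> 1"
  by (simp add: norm_Pair)

lemma mem_circle_iff: "(u::real, v::real) \<in> sphere 0 1 \<longleftrightarrow> u\<^sup>2 + v\<^sup>2 = 1"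
  by (simp add: norm_Pair)

lemma mem_disc_slice:
  assumes "\<bar>v\<bar> \<le> (1::real)"
  shows "u\<^sup>2 + v\<^sup>2 \<le> 1 \<longleftrightarrow> u \<in> {- sqrt (1 - v\<^sup>2)..sqrt (1 - v\<^sup>2)}"
proof -
  have "u\<^sup>2 + v\<^sup>2 \<le> 1 \<longleftrightarrow> u\<^sup>2 \<le> 1 - v\<^sup>2" by linarith
  also have "\<dots> \<longleftrightarrow> sqrt (u\<^sup>2) \<le> sqrt (1 - v\<^sup>2)" by (rule real_sqrt_le_iff[symmetric])
  finally show ?thesis by auto
qed

text \<open>The set is a chord of the disc with endpoints on the circle, where \<open>g\<close>
  vanishes, so the fundamental theorem of calculus gives 0. For \<open>\<bar>v\<bar> > 1\<close> the
  chord is empty.\<close>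

lemma LINT_chord_eq_0:
  fixes g g' :: "real \<Rightarrow> real"
  assumes deriv: "\<And>x. x\<^sup>2 + v\<^sup>2 \<le> 1 \<Longrightarrow> (g has_vector_derivative g' x) (at x within {x. x\<^sup>2 + v\<^sup>2 \<le> 1})"
    and cont: "continuous_on {x. x\<^sup>2 + v\<^sup>2 \<le> 1} g'"
    and zero: "\<And>x. x\<^sup>2 + v\<^sup>2 = 1 \<Longrightarrow> g x = 0"
  shows "(LINT x|lborel. indicator {x. x\<^sup>2 + v\<^sup>2 \<le> 1} x * g' x) = 0"
proof (cases "\<bar>v\<bar> \<le> 1")
  case True
  define s where "s = sqrt (1 - v\<^sup>2)"
  have chord: "{x. x\<^sup>2 + v\<^sup>2 \<le> 1} = {- s..s}"
    unfolding s_def using mem_disc_slice[OF True] by blast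
  have v: "v\<^sup>2 \<le> 1"
    using True by (simp add: abs_square_le_1)
  then have "0 \<le> s" "s\<^sup>2 + v\<^sup>2 = 1"
    by (auto simp: s_def)
  then have "g s = 0" "g (- s) = 0" "- s \<le> s"
    by (auto intro: zero)
  moreover have "(g has_vector_derivative g' x) (at x within {- s..s})" if "- s \<le> x" "x \<le> s" for x
    using deriv[of x] that chord by (metis (no_types, lifting) atLeastAtMost_iff mem_Collect_eq)
  ultimately show ?thesis
    using integral_FTC_atLeastAtMost[of "- s" s g g'] cont unfolding chord by simp
next
  case False
  then have "1 < v\<^sup>2" by (simp add: one_less_power abs_square_le_1 not_le[symmetric])
  then have "{x. x\<^sup>2 + v\<^sup>2 \<le> 1} = {}"
    using zero_le_power2 by (smt (verit) Collect_empty_eq)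
  then show ?thesis by simp
qed

text \<open>Fubini makes the direction of differentiation the inner integration variable; each inner
  integral is then a chord integral and vanishes.\<close>

lemma integral_deriv_eq_0_of_boundary:
  fixes f :: "real \<times> real \<Rightarrow> real"
  assumes f: "C_on_disc 1 f" and zero: "\<And>p. p \<in> sphere 0 1 \<Longrightarrow> f p = 0"
  shows "integral disc (deriv_u f) = 0" "integral disc (deriv_v f) = 0"
proof -
  have cont: "continuous_on disc (deriv_u f)" "continuous_on disc (deriv_v f)"
    using f by simp_all
  have D: "(f has_derivative (\<lambda>h. fst h *\<^sub>R deriv_u f p + snd h *\<^sub>R deriv_v f p)) (at p within disc)"
    if "p \<in> disc" for p
    using f that by (intro differentiable_has_derivative_disc) simp_all
  have "integral disc (deriv_u f) = (LINT v|lborel. LINT u|lborel. indicator disc (u, v) * deriv_u f (u, v))"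
    unfolding integral_lborel_disc(3)[OF cont(1)]
    using integral_lborel_disc(1)[OF cont(1)]
    by (subst lborel_pair.integral_snd) (simp_all add: lborel_prod split_def)
  also have "\<dots> = (LINT v::real|lborel. 0)"
  proof (intro Bochner_Integration.integral_cong refl)
    fix v :: real
    have slice: "(x, v) \<in> disc \<longleftrightarrow> x\<^sup>2 + v\<^sup>2 \<le> 1" for x
      unfolding mem_disc_iff by linarith
    then have image: "(\<lambda>u. (u, v)) ` {x. x\<^sup>2 + v\<^sup>2 \<le> 1} \<subseteq> disc"
      by blast
    have "((\<lambda>u. f (u, v)) has_vector_derivative deriv_u f (x, v)) (at x within {x. x\<^sup>2 + v\<^sup>2 \<le> 1})"
      if "x\<^sup>2 + v\<^sup>2 \<le> 1" for x
    proof -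
      have "((\<lambda>u. (u, v)) has_derivative (\<lambda>h. (h, 0))) (at x within {x. x\<^sup>2 + v\<^sup>2 \<le> 1})"
        by (auto intro!: derivative_eq_intros)
      from has_derivative_in_compose[OF this has_derivative_subset[OF D image]] that slice
      show ?thesis
        by (simp only: has_vector_derivative_def fst_conv snd_conv scaleR_zero_left add_0_right add_0_left)
    qed
    moreover have "continuous_on {x. x\<^sup>2 + v\<^sup>2 \<le> 1} (\<lambda>u. deriv_u f (u, v))"
      by (rule continuous_on_compose2[OF cont(1) _ image]) (intro continuous_intros)
    moreover have "f (x, v) = 0" if "x\<^sup>2 + v\<^sup>2 = 1" for x
      using that by (intro zero) (simp only: mem_circle_iff add.commute)
    moreover have "indicator disc (x, v) = (indicator {x. x\<^sup>2 + v\<^sup>2 \<le> 1} x :: real)" for x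
      using slice by (simp only: indicator_def mem_Collect_eq)
    ultimately show "(LINT u|lborel. indicator disc (u, v) * deriv_u f (u, v)) = 0"
      using LINT_chord_eq_0[of v "\<lambda>u. f (u, v)" "\<lambda>u. deriv_u f (u, v)"] by simp
  qed
  finally show "integral disc (deriv_u f) = 0" by simp
  have "integral disc (deriv_v f) = (LINT u|lborel. LINT v|lborel. indicator disc (u, v) * deriv_v f (u, v))"
    unfolding integral_lborel_disc(3)[OF cont(2)]
    using integral_lborel_disc(1)[OF cont(2)]
    by (subst lborel_pair.integral_fst') (simp_all add: lborel_prod)
  also have "\<dots> = (LINT u::real|lborel. 0)"
  proof (intro Bochner_Integration.integral_cong refl)
    fix u :: real
    \<comment> \<open>The squares are swapped to match the chord lemma, with \<open>u\<close> now in
      the role of its fixed parameter.\<close>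
    have slice: "(u, x) \<in> disc \<longleftrightarrow> x\<^sup>2 + u\<^sup>2 \<le> 1" for x
      unfolding mem_disc_iff by linarith
    then have image: "(\<lambda>v. (u, v)) ` {x. x\<^sup>2 + u\<^sup>2 \<le> 1} \<subseteq> disc"
      by blast
    have "((\<lambda>v. f (u, v)) has_vector_derivative deriv_v f (u, x)) (at x within {x. x\<^sup>2 + u\<^sup>2 \<le> 1})"
      if "x\<^sup>2 + u\<^sup>2 \<le> 1" for x
    proof -
      have "((\<lambda>v. (u, v)) has_derivative (\<lambda>h. (0, h))) (at x within {x. x\<^sup>2 + u\<^sup>2 \<le> 1})"
        by (auto intro!: derivative_eq_intros)
      from has_derivative_in_compose[OF this has_derivative_subset[OF D image]] that slice
      show ?thesis
        by (simp only: has_vector_derivative_def fst_conv snd_conv scaleR_zero_left add_0_right add_0_left)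
    qed
    moreover have "continuous_on {x. x\<^sup>2 + u\<^sup>2 \<le> 1} (\<lambda>v. deriv_v f (u, v))"
      by (rule continuous_on_compose2[OF cont(2) _ image]) (intro continuous_intros)
    moreover have "f (u, x) = 0" if "x\<^sup>2 + u\<^sup>2 = 1" for x
      using that by (intro zero) (simp only: mem_circle_iff add.commute)
    moreover have "indicator disc (u, x) = (indicator {x. x\<^sup>2 + u\<^sup>2 \<le> 1} x :: real)" for x
      using slice by (simp only: indicator_def mem_Collect_eq)
    ultimately show "(LINT v|lborel. indicator disc (u, v) * deriv_v f (u, v)) = 0"
      using LINT_chord_eq_0[of u "\<lambda>v. f (u, v)" "\<lambda>v. deriv_v f (u, v)"] by simp
  qed
  finally show "integral disc (deriv_v f) = 0" by simp
qed

lemma C_on_disc_ident: "C_on_disc k (\<lambda>p. p)"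
proof (cases k)
  case (Suc j)
  show ?thesis
    unfolding Suc by (rule C_on_disc_SucI[OF has_derivative_ident]) (rule C_on_disc_const)+
qed (simp add: continuous_on_id)

section \<open>Product rules and divergences\<close>

lemma deriv_disc_mult:
  fixes f g :: "real \<times> real \<Rightarrow> real"
  assumes "f differentiable_on disc" "g differentiable_on disc" "p \<in> disc"
  shows "deriv_u (\<lambda>p. f p * g p) p = f p * deriv_u g p + deriv_u f p * g p"
    and "deriv_v (\<lambda>p. f p * g p) p = f p * deriv_v g p + deriv_v f p * g p"
  using deriv_disc_eq[OF has_derivative_mult[OF differentiable_has_derivative_disc[OF assms(1,3)]
      differentiable_has_derivative_disc[OF assms(2,3)]] assms(3)] by simp_all

lemma divergence_mult:
  fixes a b f :: "real \<times> real \<Rightarrow> real"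
  assumes "f differentiable_on disc" "a differentiable_on disc" "b differentiable_on disc" "p \<in> disc"
  shows "divergence (\<lambda>p. f p * a p) (\<lambda>p. f p * b p) p =
    f p * divergence a b p + (deriv_u f p * a p + deriv_v f p * b p)"
  unfolding divergence_def deriv_disc_mult(1)[OF assms(1,2,4)] deriv_disc_mult(2)[OF assms(1,3,4)]
  by (simp add: algebra_simps)

lemma divergence_continuous:
  assumes "C_on_disc 1 a" "C_on_disc 1 b"
  shows "continuous_on disc (divergence a b)"
  using assms by (auto simp: divergence_def[abs_def] intro!: continuous_intros)

lemma divergence_fst_snd:
  assumes "p \<in> disc"
  shows "divergence fst snd p = 2"
  unfolding divergence_def
  using deriv_disc_eq[OF has_derivative_fst[OF has_derivative_ident] assms]
    deriv_disc_eq[OF has_derivative_snd[OF has_derivative_ident] assms] by simp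

lemma integrable_disc_cont:
  fixes f :: "real \<times> real \<Rightarrow> real"
  shows "continuous_on disc f \<Longrightarrow> f integrable_on disc"
  by (rule integral_lborel_disc)

lemma integral_divergence_eq_0_of_boundary:
  fixes a b :: "real \<times> real \<Rightarrow> real"
  assumes "C_on_disc 1 a" "C_on_disc 1 b"
    and "\<And>p. p \<in> sphere 0 1 \<Longrightarrow> a p = 0" "\<And>p. p \<in> sphere 0 1 \<Longrightarrow> b p = 0"
  shows "integral disc (divergence a b) = 0"
proof -
  have "integral disc (\<lambda>p. deriv_u a p + deriv_v b p) = integral disc (deriv_u a) + integral disc (deriv_v b)"
    using assms(1,2) by (intro Henstock_Kurzweil_Integration.integral_add integrable_disc_cont) simp_all
  also have "\<dots> = 0"
    using integral_deriv_eq_0_of_boundary assms by simp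
  finally show ?thesis by (simp add: divergence_def[abs_def])
qed

text \<open>The weights \<open>2 (n + 1) \<bar>p\<bar>^(2 n)\<close> concentrate near the unit circle, where they converge to
  arc length; integrals against them replace boundary integrals.\<close>

definition shell_integral :: "nat \<Rightarrow> (real \<times> real \<Rightarrow> real) \<Rightarrow> real"
  where "shell_integral n g = integral disc (\<lambda>p. 2 * real (Suc n) * (p \<bullet> p) ^ n * g p)"

lemma inner_self_disc: "p \<in> disc \<Longrightarrow> (p::real \<times> real) \<bullet> p \<le> 1"
  by (simp add: dot_square_norm abs_square_le_1)

lemma inner_self_circle: "p \<in> sphere 0 1 \<Longrightarrow> (p::real \<times> real) \<bullet> p = 1"
  by (simp add: dot_square_norm)

text \<open>Apply the divergence theorem to \<open>(1 - \<bar>p\<bar>^(2 (n + 1))) (a, b)\<close>, which vanishes on the circle.\<close>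

lemma shell_integral_flux:
  assumes a: "C_on_disc 1 a" and b: "C_on_disc 1 b"
  shows "shell_integral n (\<lambda>p. p \<bullet> (a p, b p)) =
    integral disc (\<lambda>p. (1 - (p \<bullet> p) ^ Suc n) * divergence a b p)"
proof -
  define f where "f = (\<lambda>p::real \<times> real. 1 - (p \<bullet> p) ^ Suc n)"
  have Df: "(f has_derivative (\<lambda>h. - (2 * real (Suc n) * (p \<bullet> p) ^ n * (p \<bullet> h)))) (at p within disc)" for p
  proof -
    have "((\<lambda>p. p \<bullet> p) has_derivative (\<lambda>h. 2 * (p \<bullet> h))) (at p within disc)"
      by (auto intro!: derivative_eq_intros simp: inner_commute)
    from has_derivative_diff[OF has_derivative_const has_derivative_power[OF this, of "Suc n"]]
    show ?thesis
      unfolding f_def by (simp add: mult_ac)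
  qed
  have f1: "C_on_disc 1 f"
    unfolding One_nat_def
    by (rule C_on_disc_SucI[OF Df]) (auto intro!: continuous_intros)
  have "f differentiable_on disc" "a differentiable_on disc" "b differentiable_on disc"
    using f1 a b by simp_all
  note div = divergence_mult[OF this]
  have "0 = integral disc (divergence (\<lambda>p. f p * a p) (\<lambda>p. f p * b p))"
    by (rule integral_divergence_eq_0_of_boundary[symmetric])
       (use C_on_disc_mult[OF f1 a] C_on_disc_mult[OF f1 b] inner_self_circle in \<open>auto simp: f_def\<close>)
  also have "\<dots> = integral disc (\<lambda>p. f p * divergence a b p - 2 * real (Suc n) * (p \<bullet> p) ^ n * (p \<bullet> (a p, b p)))"
  proof (rule Henstock_Kurzweil_Integration.integral_cong)
    fix p :: "real \<times> real" assume p: "p \<in> disc"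
    show "divergence (\<lambda>p. f p * a p) (\<lambda>p. f p * b p) p =
      f p * divergence a b p - 2 * real (Suc n) * (p \<bullet> p) ^ n * (p \<bullet> (a p, b p))"
      unfolding div[OF p] deriv_disc_eq[OF Df p] by (simp add: inner_prod_def algebra_simps)
  qed
  also have "\<dots> = integral disc (\<lambda>p. f p * divergence a b p) - shell_integral n (\<lambda>p. p \<bullet> (a p, b p))"
    unfolding shell_integral_def
    using C_on_disc_continuous[OF a] C_on_disc_continuous[OF b] C_on_disc_continuous[OF f1]
      divergence_continuous[OF a b]
    by (intro Henstock_Kurzweil_Integration.integral_diff integrable_disc_cont continuous_intros)
  finally show ?thesis by (simp add: f_def)
qed

text \<open>The flux identity for the position field gives the recursion for these moments, so no polar
  coordinates are needed.\<close>

lemma integral_disc_power: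
  "integral disc (\<lambda>p. (p \<bullet> p) ^ n) = integral disc (\<lambda>_. 1) / real (Suc n)"
proof (cases n)
  case (Suc m)
  have "integral disc (\<lambda>p. (1 - (p \<bullet> p) ^ Suc m) * divergence fst snd p) =
      integral disc (\<lambda>p. 2 * (1 - (p \<bullet> p) ^ Suc m))"
    by (intro Henstock_Kurzweil_Integration.integral_cong) (simp add: divergence_fst_snd del: mem_cball_0)
  also have "\<dots> = 2 * (integral disc (\<lambda>_. 1) - integral disc (\<lambda>p. (p \<bullet> p) ^ Suc m))"
    by (subst Henstock_Kurzweil_Integration.integral_mult_right,
        subst Henstock_Kurzweil_Integration.integral_diff)
       (auto intro!: integrable_disc_cont continuous_intros)
  finally have "shell_integral m (\<lambda>p. p \<bullet> p) = \<dots>"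
    using shell_integral_flux[OF C_on_disc_fst_snd, of m] by simp
  moreover have "shell_integral m (\<lambda>p. p \<bullet> p) = 2 * real (Suc m) * integral disc (\<lambda>p. (p \<bullet> p) ^ Suc m)"
    unfolding shell_integral_def
    by (subst Henstock_Kurzweil_Integration.integral_mult_right[symmetric]) (simp add: mult_ac)
  \<comment> \<open>With \<open>M\<close> the moment of order \<open>Suc m\<close> and
    \<open>A\<close> the area, the two facts read \<open>2 (m + 1) M = 2 (A - M)\<close>, hence
    \<open>M = A / (m + 2)\<close>.\<close>
  ultimately show ?thesis
    by (simp add: Suc field_simps)
qed simp

text \<open>With a bound \<open>B\<close> for \<bar>d\<bar> and \<open>A\<close> the area, the
  moment formula bounds the integral by \<open>B A / (n + 1)\<close>.\<close>

lemma integral_disc_power_mult_tendsto_0: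
  assumes "continuous_on disc d"
  shows "(\<lambda>n. integral disc (\<lambda>p. (p \<bullet> p) ^ n * d p)) \<longlonglongrightarrow> 0"
proof -
  have "bounded (d ` disc)"
    by (intro compact_imp_bounded compact_continuous_image assms compact_cball)
  then obtain B where B: "\<bar>d p\<bar> \<le> B" if "p \<in> disc" for p
    by (fastforce simp: bounded_iff)
  have "norm (integral disc (\<lambda>p. (p \<bullet> p) ^ n * d p)) \<le> B * integral disc (\<lambda>_. 1) * inverse (real (Suc n))" for n
  proof -
    have "norm (integral disc (\<lambda>p. (p \<bullet> p) ^ n * d p)) \<le> integral disc (\<lambda>p. B * (p \<bullet> p) ^ n)"
    proof (rule Henstock_Kurzweil_Integration.integral_norm_bound_integral)
      show "norm ((p \<bullet> p) ^ n * d p) \<le> B * (p \<bullet> p) ^ n" if "p \<in> disc" for p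
        using B[OF that] by (simp add: abs_mult mult.commute mult_right_mono)
    qed (intro integrable_disc_cont continuous_intros assms)+
    then show ?thesis
      by (simp add: integral_disc_power divide_inverse mult_ac)
  qed
  then show ?thesis
    by (intro Lim_null_comparison[OF always_eventually tendsto_mult_right_zero[OF LIMSEQ_inverse_real_of_nat]]) blast
qed

text \<open>The divergence theorem with the boundary flux expressed as a limit. In the exact
  identity for finite \<open>n\<close> the error is a moment-weighted integral of the divergence,
  which tends to 0.\<close>

lemma shell_integral_flux_tendsto:
  assumes a: "C_on_disc 1 a" and b: "C_on_disc 1 b"
  shows "(\<lambda>n. shell_integral n (\<lambda>p. p \<bullet> (a p, b p))) \<longlonglongrightarrow> integral disc (divergence a b)"
proof -
  have "shell_integral n (\<lambda>p. p \<bullet> (a p, b p)) =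
      integral disc (divergence a b) - integral disc (\<lambda>p. (p \<bullet> p) ^ Suc n * divergence a b p)" for n
    unfolding shell_integral_flux[OF a b] left_diff_distrib mult_1
    using divergence_continuous[OF a b]
    by (intro Henstock_Kurzweil_Integration.integral_diff integrable_disc_cont continuous_intros)
  moreover have "(\<lambda>n. integral disc (divergence a b) - integral disc (\<lambda>p. (p \<bullet> p) ^ Suc n * divergence a b p))
      \<longlonglongrightarrow> integral disc (divergence a b) - 0"
    by (intro tendsto_intros LIMSEQ_Suc integral_disc_power_mult_tendsto_0 divergence_continuous a b)
  ultimately show ?thesis by simp
qed

section \<open>Shell integrals of functions that vanish on the circle\<close>

lemma shell_integral_mono:
  assumes "continuous_on disc f" "continuous_on disc g" "\<And>p. p \<in> disc \<Longrightarrow> f p \<le> g p"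
  shows "shell_integral n f \<le> shell_integral n g"
  unfolding shell_integral_def
  by (intro Henstock_Kurzweil_Integration.integral_le integrable_disc_cont continuous_intros assms
      mult_left_mono) auto

text \<open>These are the comparison functions for the next estimate. The term in
  \<open>1 - p \<bullet> p\<close>, which vanishes on the circle, contributes only
  \<open>O(1/n)\<close>, while the constant \<open>c\<close> contributes \<open>2 c\<close> times
  the area.\<close>

lemma shell_integral_linear_combination:
  "shell_integral n (\<lambda>p. c + d * (1 - p \<bullet> p)) = integral disc (\<lambda>_. 1) * (2 * c + 2 * d / real (n + 2))"
proof -
  have "shell_integral n (\<lambda>p. c + d * (1 - p \<bullet> p)) =
     integral disc (\<lambda>p. (2 * real (Suc n) * (c + d)) * (p \<bullet> p) ^ n - (2 * real (Suc n) * d) * (p \<bullet> p) ^ Suc n)"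
    unfolding shell_integral_def
    by (intro Henstock_Kurzweil_Integration.integral_cong) (simp add: algebra_simps)
  also have "\<dots> = (2 * real (Suc n) * (c + d)) * integral disc (\<lambda>p. (p \<bullet> p) ^ n)
       - (2 * real (Suc n) * d) * integral disc (\<lambda>p. (p \<bullet> p) ^ Suc n)"
    by (subst Henstock_Kurzweil_Integration.integral_diff)
       (intro integrable_disc_cont continuous_intros | simp only: Henstock_Kurzweil_Integration.integral_mult_right)+
  also have "\<dots> = integral disc (\<lambda>_. 1) * (2 * c + 2 * d / real (n + 2))"
  proof -
    have "2 * real (Suc n) * (c + d) * (A / real (Suc n)) - 2 * real (Suc n) * d * (A / real (Suc (Suc n))) =
        A * (2 * c + 2 * d / real (n + 2))" for A
    proof -
      have "2 * real (Suc n) * (c + d) * (A / real (Suc n)) = 2 * (c + d) * A"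
        by (simp add: field_simps del: of_nat_Suc)
      moreover have "2 * real (Suc n) * d * (A / real (Suc (Suc n))) = 2 * d * A - 2 * d * A / real (n + 2)"
        by (simp add: field_simps)
      ultimately show ?thesis by (simp add: algebra_simps)
    qed
    then show ?thesis unfolding integral_disc_power .
  qed
  finally show ?thesis .
qed

text \<open>For every \<epsilon> some \<open>C\<close> gives \<bar>g\<bar> \<le> \<epsilon> + C (1 -
  p \<bullet> p) on the disc, and the shell integral of this majorant tends to 2 \<epsilon> times
  the area.\<close>

lemma shell_integral_tendsto_0:
  assumes g: "continuous_on disc g" and zero: "\<And>p. p \<in> sphere 0 1 \<Longrightarrow> g p = 0"
  shows "(\<lambda>n. shell_integral n g) \<longlonglongrightarrow> 0"
proof (rule LIMSEQ_I)
  fix e :: real assume "0 < e"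
  define A where "A = integral disc (\<lambda>_::real \<times> real. 1::real)"
  have "0 \<le> A"
    unfolding A_def by (intro Henstock_Kurzweil_Integration.integral_nonneg integrable_disc_cont continuous_intros) simp
  \<comment> \<open>Chosen to give \<open>2 * \<epsilon> * A < e\<close>; the summand 1 keeps the
    denominator positive when only \<open>0 \<le> A\<close> is known.\<close>
  define \<epsilon> where "\<epsilon> = e / (4 * (A + 1))"
  have "0 < \<epsilon>" using \<open>0 < e\<close> \<open>0 \<le> A\<close> by (simp add: \<epsilon>_def)
  have "2 * \<epsilon> * A < e"
  proof -
    have "A * (2 * e) < e * (4 * (A + 1))"
      using \<open>0 < e\<close> mult_nonneg_nonneg[of A e] \<open>0 \<le> A\<close> by (simp add: algebra_simps add_pos_nonneg)
    then show ?thesis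
      using \<open>0 \<le> A\<close> by (simp add: \<epsilon>_def pos_divide_less_eq mult_ac)
  qed
  \<comment> \<open>As \<open>g\<close> vanishes on the circle, this compact set lies in the open
    disc, so the quotient of \<bar>g\<bar> by \<open>1 - p \<bullet> p\<close> is bounded on
    it.\<close>
  define K where "K = disc \<inter> g -` {x. \<epsilon> \<le> \<bar>x\<bar>}"
  have "closed K"
    unfolding K_def
    by (intro continuous_closed_preimage[OF g closed_cball] closed_Collect_le continuous_intros)
  then have "compact K"
    using compact_Int_closed[OF compact_cball, of K 0 1] by (simp add: K_def Int_absorb1 inf_assoc[symmetric])
  \<comment> \<open>Away from the circle \<open>1 - p \<bullet> p\<close> is bounded below, near it \<open>g\<close> is small.\<close>
  have "\<exists>C. \<forall>p\<in>disc. \<bar>g p\<bar> \<le> \<epsilon> + C * (1 - p \<bullet> p)"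
  proof -
    have pos: "1 - p \<bullet> p > 0" if "p \<in> K" for p
    proof -
      have "p \<in> disc" "p \<notin> sphere 0 1"
        using that zero[of p] \<open>0 < \<epsilon>\<close> by (auto simp: K_def)
      then have "norm p < 1" by simp
      then show ?thesis by (simp add: dot_square_norm abs_square_less_1)
    qed
    have "continuous_on K g"
      using g by (rule continuous_on_subset) (simp add: K_def)
    moreover have "\<forall>p\<in>K. 1 - p \<bullet> p \<noteq> 0"
      using pos by fastforce
    ultimately have "continuous_on K (\<lambda>p. \<bar>g p\<bar> / (1 - p \<bullet> p))"
      by (intro continuous_intros)
    then have "bounded ((\<lambda>p. \<bar>g p\<bar> / (1 - p \<bullet> p)) ` K)"
      by (intro compact_imp_bounded compact_continuous_image \<open>compact K\<close>)
    then obtain C where "0 < C" and C: "\<And>p. p \<in> K \<Longrightarrow> norm (\<bar>g p\<bar> / (1 - p \<bullet> p)) \<le> C"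
      unfolding bounded_pos by blast
    have "\<bar>g p\<bar> \<le> \<epsilon> + C * (1 - p \<bullet> p)" if p: "p \<in> disc" for p
    proof (cases "p \<in> K")
      case True
      then have "\<bar>g p\<bar> \<le> C * (1 - p \<bullet> p)"
        using C[OF True] pos[OF True] by (simp add: field_simps)
      then show ?thesis using \<open>0 < \<epsilon>\<close> by linarith
    next
      case False
      then have "\<bar>g p\<bar> \<le> \<epsilon>" using p by (simp add: K_def)
      moreover have "0 \<le> C * (1 - p \<bullet> p)"
        using \<open>0 < C\<close> inner_self_disc[OF p] by simp
      ultimately show ?thesis by linarith
    qed
    then show ?thesis by blast
  qed
  then obtain C where C: "\<bar>g p\<bar> \<le> \<epsilon> + C * (1 - p \<bullet> p)" if "p \<in> disc" for p
    by blast
  have bound: "\<bar>shell_integral n g\<bar> \<le> A * (2 * \<epsilon> + 2 * C / real (n + 2))" for n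
  proof -
    have "shell_integral n g \<le> A * (2 * \<epsilon> + 2 * C / real (n + 2))"
      unfolding A_def shell_integral_linear_combination[symmetric]
      by (rule shell_integral_mono) (use g C in \<open>auto intro!: continuous_intros simp: abs_le_iff\<close>)
    moreover have "A * (2 * (- \<epsilon>) + 2 * (- C) / real (n + 2)) \<le> shell_integral n g"
      unfolding A_def shell_integral_linear_combination[symmetric]
    proof (rule shell_integral_mono)
      show "- \<epsilon> + - C * (1 - p \<bullet> p) \<le> g p" if "p \<in> disc" for p
        using C[OF that] by (simp add: abs_le_iff algebra_simps)
    qed (use g in \<open>auto intro!: continuous_intros\<close>)
    ultimately show ?thesis by (simp add: abs_le_iff algebra_simps)
  qed
  have "(\<lambda>n. A * (2 * \<epsilon> + 2 * C / real (n + 2))) \<longlonglongrightarrow> A * (2 * \<epsilon> + 0)"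
    by (intro tendsto_intros LIMSEQ_ignore_initial_segment[of "\<lambda>n. 2 * C / real n" 0 2] lim_const_over_n)
  then have "\<forall>\<^sub>F n in sequentially. A * (2 * \<epsilon> + 2 * C / real (n + 2)) < e"
    using \<open>2 * \<epsilon> * A < e\<close> by (intro order_tendstoD(2)) (auto simp: mult_ac)
  then show "\<exists>N. \<forall>n\<ge>N. norm (shell_integral n g - 0) < e"
    unfolding eventually_sequentially using bound by (auto intro: le_less_trans)
qed

text \<open>The shell integrals of the normal component tend both to the integral of the divergence
  and to 0. Compared with the chord argument, only the normal component has to vanish on the
  circle.\<close>

corollary integral_divergence_eq_0:
  assumes "C_on_disc 1 a" "C_on_disc 1 b" "\<And>p. p \<in> sphere 0 1 \<Longrightarrow> p \<bullet> (a p, b p) = 0"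
  shows "integral disc (divergence a b) = 0"
proof (rule LIMSEQ_unique[OF shell_integral_flux_tendsto[OF assms(1,2)] shell_integral_tendsto_0])
  show "continuous_on disc (\<lambda>p. p \<bullet> (a p, b p))"
    using assms(1,2) by (intro continuous_intros C_on_disc_continuous)
qed (rule assms(3))

section \<open>Weak and strong solutions\<close>

text \<open>The circle is a null set and the disc is the closure of the open ball, so the conclusion
  reaches boundary points too; the normal component argument uses it at one.\<close>

lemma integral_disc_nonneg_eq_0D:
  fixes f :: "real \<times> real \<Rightarrow> real"
  assumes "continuous_on disc f" "\<And>p. p \<in> disc \<Longrightarrow> 0 \<le> f p" "integral disc f = 0" "p \<in> disc"
  shows "f p = 0"
proof (rule has_integral_0_closure_imp_0[where S = "ball 0 1" and f = f and x = p])
  show "(f has_integral 0) (closure (ball 0 1))"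
    using integrable_integral[OF integrable_disc_cont[OF assms(1)]] assms(3) by simp
  show "0 < emeasure lborel (ball (0 :: real \<times> real) 1)" "emeasure lborel (ball (0 :: real \<times> real) 1) < \<infinity>"
    "emeasure lborel (closure (ball (0 :: real \<times> real) 1)) = emeasure lborel (ball (0 :: real \<times> real) 1)"
    by (simp_all add: emeasure_ball emeasure_cball unit_ball_vol_pos)
qed (use assms in auto)

lemma integral_divergence_mult:
  assumes f: "C_on_disc 1 f" and a: "C_on_disc 1 a" and b: "C_on_disc 1 b"
  shows "integral disc (divergence (\<lambda>p. f p * a p) (\<lambda>p. f p * b p)) =
    integral disc (\<lambda>p. f p * divergence a b p) + integral disc (\<lambda>p. deriv_u f p * a p + deriv_v f p * b p)"
proof -
  have "integral disc (divergence (\<lambda>p. f p * a p) (\<lambda>p. f p * b p)) =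
    integral disc (\<lambda>p. f p * divergence a b p + (deriv_u f p * a p + deriv_v f p * b p))"
    using assms by (intro Henstock_Kurzweil_Integration.integral_cong divergence_mult) simp_all
  also have "\<dots> = integral disc (\<lambda>p. f p * divergence a b p) + integral disc (\<lambda>p. deriv_u f p * a p + deriv_v f p * b p)"
    using assms C_on_disc_continuous[OF a] C_on_disc_continuous[OF b] C_on_disc_continuous[OF f]
    by (intro Henstock_Kurzweil_Integration.integral_add integrable_disc_cont continuous_intros
        divergence_continuous) simp_all
  finally show ?thesis .
qed

lemma shell_integral_cmult: "shell_integral n (\<lambda>p. k * g p) = k * shell_integral n g"
  unfolding shell_integral_def
  by (subst Henstock_Kurzweil_Integration.integral_mult_right[symmetric]) (simp add: mult_ac)

text \<open>If the divergence were nonzero at an interior point \<open>z\<close>, a cutoff near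
  \<open>z\<close> that vanishes on the circle would make the integral of \<psi> times the
  normalised divergence zero, although the integrand is nonnegative and positive at
  \<open>z\<close>. Continuity extends the result to the circle.\<close>

lemma divergence_eq_0_of_weak:
  assumes a: "C_on_disc 1 a" and b: "C_on_disc 1 b"
    and weak: "\<And>f. C_on_disc 3 f \<Longrightarrow> integral disc (\<lambda>p. deriv_u f p * a p + deriv_v f p * b p) = 0"
    and p: "p \<in> disc"
  shows "divergence a b p = 0"
proof (rule continuous_constant_on_closure[where S = "ball 0 1" and f = "divergence a b"])
  show "divergence a b z = 0" if z: "z \<in> ball 0 1" for z
  proof (rule ccontr)
    assume nz: "divergence a b z \<noteq> 0"
    \<comment> \<open>Dividing by the value at \<open>z\<close> treats both signs at once:
      \<open>h z = 1\<close>, so \<open>h\<close> is positive near \<open>z\<close>.\<close>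
    define h where "h = (\<lambda>p. divergence a b p / divergence a b z)"
    have cont: "continuous_on disc h"
      unfolding h_def using nz by (intro continuous_intros divergence_continuous a b) simp
    have "h z = 1" using nz by (simp add: h_def)
    have "z \<in> disc" using z by simp
    then obtain \<delta> where "0 < \<delta>" and \<delta>: "\<And>p. p \<in> disc \<Longrightarrow> dist p z < \<delta> \<Longrightarrow> dist (h p) (h z) < 1"
      using cont unfolding continuous_on_iff by (metis zero_less_one)
    \<comment> \<open>The first factor kills the boundary values, so the \<delta>-ball may stick out
      of the disc. The second vanishes outside that ball and is C^3 by its fourth power.\<close>
    define \<psi> where "\<psi> = (\<lambda>p. (1 - p \<bullet> p) * max 0 (\<delta>\<^sup>2 - (p - z) \<bullet> (p - z)) ^ 4)"
    have \<psi>: "C_on_disc 3 \<psi>"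
      unfolding \<psi>_def
      by (intro C_on_disc_mult C_on_disc_positive_part_power[of 3, simplified] C_on_disc_diff
          C_on_disc_inner C_on_disc_const C_on_disc_ident)
    then have \<psi>1: "C_on_disc 1 \<psi>" by (rule C_on_disc_mono) simp
    have "0 = integral disc (divergence (\<lambda>p. \<psi> p * a p) (\<lambda>p. \<psi> p * b p))"
      by (rule integral_divergence_eq_0_of_boundary[symmetric])
         (use C_on_disc_mult[OF \<psi>1 a] C_on_disc_mult[OF \<psi>1 b] inner_self_circle in \<open>auto simp: \<psi>_def\<close>)
    also have "\<dots> = integral disc (\<lambda>p. \<psi> p * divergence a b p)"
      using integral_divergence_mult[OF \<psi>1 a b] weak[OF \<psi>] by simp
    finally have "integral disc (\<lambda>p. \<psi> p * h p) = 0"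
      by (simp add: h_def)
    moreover have "0 \<le> \<psi> p * h p" if "p \<in> disc" for p
    proof (cases "dist p z < \<delta>")
      case True
      then have "0 \<le> h p"
        using \<delta>[OF that] \<open>h z = 1\<close> by (simp add: dist_real_def)
      then show ?thesis
        using inner_self_disc[OF that] by (simp add: \<psi>_def)
    next
      case False
      then have "\<delta>\<^sup>2 \<le> (p - z) \<bullet> (p - z)"
        using \<open>0 < \<delta>\<close> by (simp add: dist_norm dot_square_norm power_mono)
      then show ?thesis by (simp add: \<psi>_def)
    qed
    ultimately have "\<psi> z * h z = 0"
      using C_on_disc_continuous[OF \<psi>] cont \<open>z \<in> disc\<close>
      by (intro integral_disc_nonneg_eq_0D[where f = "\<lambda>p. \<psi> p * h p"]) (auto intro!: continuous_intros)
    moreover have "z \<bullet> z < 1"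
      using z by (simp add: dot_square_norm abs_square_less_1)
    ultimately show False
      using \<open>h z = 1\<close> \<open>0 < \<delta>\<close> by (simp add: \<psi>_def)
  qed
qed (use divergence_continuous[OF a b] p in auto)

text \<open>The divergence is already zero, so the flux of \<psi> (a, b) vanishes in the limit for
  every test function \<psi>. A normal component nonzero at \<open>z\<close> would, after scaling,
  dominate the radial one near \<open>z\<close>, forcing the radial field \<psi> p to have total
  divergence at most 0, which a cap cutoff contradicts.\<close>

lemma normal_component_eq_0_of_weak:
  assumes a: "C_on_disc 1 a" and b: "C_on_disc 1 b"
    and weak: "\<And>f. C_on_disc 3 f \<Longrightarrow> integral disc (\<lambda>p. deriv_u f p * a p + deriv_v f p * b p) = 0"
    and z: "z \<in> sphere 0 1"
  shows "z \<bullet> (a z, b z) = 0"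
proof (rule ccontr)
  assume nz: "z \<bullet> (a z, b z) \<noteq> 0"
  \<comment> \<open>Absorbs the sign and makes \<open>g z = 2\<close>; a tolerance of 1 then leaves
    \<open>g p \<ge> 1 \<ge> p \<bullet> p\<close> near \<open>z\<close>.\<close>
  define k where "k = 2 / (z \<bullet> (a z, b z))"
  define g where "g = (\<lambda>p. k * (p \<bullet> (a p, b p)))"
  have cont: "continuous_on disc g"
    unfolding g_def using C_on_disc_continuous[OF a] C_on_disc_continuous[OF b] by (intro continuous_intros)
  have "g z = 2" using nz by (simp add: g_def k_def)
  have "z \<in> disc" "z \<bullet> z = 1" using z inner_self_circle by auto
  then obtain \<epsilon> where "0 < \<epsilon>" and \<epsilon>: "\<And>p. p \<in> disc \<Longrightarrow> dist p z < \<epsilon> \<Longrightarrow> dist (g p) (g z) < 1"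
    using cont unfolding continuous_on_iff by (metis zero_less_one)
  \<comment> \<open>On the cap \<open>p \<bullet> z > 1 - \<delta>\<close>, so the squared distance
    from \<open>p\<close> to \<open>z\<close> is below
    \<open>2 * \<delta> \<le> \<epsilon>\<^sup>2\<close>. The bound \<open>\<delta> \<le> 1\<close>
    makes \<open>p \<bullet> z\<close> nonnegative there.\<close>
  define \<delta> where "\<delta> = min 1 (\<epsilon>\<^sup>2 / 2)"
  have \<delta>: "0 < \<delta>" "\<delta> \<le> 1" "2 * \<delta> \<le> \<epsilon>\<^sup>2"
    using \<open>0 < \<epsilon>\<close> by (auto simp: \<delta>_def)
  \<comment> \<open>\<open>q\<close> is positive exactly on a circular cap around \<open>z\<close>. On it the flux of \<open>\<psi> (a, b)\<close>, suitably scaled,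
    dominates that of the radial field \<open>\<psi> p\<close>, whose divergence is nonnegative and not identically 0.\<close>
  define q where "q = (\<lambda>p. p \<bullet> z - (1 - \<delta>))"
  define \<psi> where "\<psi> = (\<lambda>p. max 0 (q p) ^ 4)"
  have \<psi>: "C_on_disc 3 \<psi>"
    unfolding \<psi>_def q_def
    by (intro C_on_disc_positive_part_power[of 3, simplified] C_on_disc_diff
        C_on_disc_inner C_on_disc_const C_on_disc_ident)
  then have \<psi>1: "C_on_disc 1 \<psi>" by (rule C_on_disc_mono) simp
  have "g p \<ge> 1" if "p \<in> disc" "q p > 0" for p
  proof -
    have "(norm (p - z))\<^sup>2 < \<epsilon>\<^sup>2"
      using that(2) inner_self_disc[OF that(1)] \<open>z \<bullet> z = 1\<close> \<delta>
      by (simp add: power2_norm_eq_inner inner_diff inner_commute q_def)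
    then have "dist p z < \<epsilon>"
      using \<open>0 < \<epsilon>\<close> by (simp add: dist_norm power_less_imp_less_base)
    then show ?thesis
      using \<epsilon>[OF that(1)] \<open>g z = 2\<close> by (simp add: dist_real_def)
  qed
  then have lower: "p \<bullet> (\<psi> p * fst p, \<psi> p * snd p) \<le> k * (p \<bullet> (\<psi> p * a p, \<psi> p * b p))"
    if "p \<in> disc" for p
  proof (cases "q p > 0")
    case True
    have "\<psi> p * (p \<bullet> p) \<le> \<psi> p * g p"
      using \<open>\<And>p. p \<in> disc \<Longrightarrow> 0 < q p \<Longrightarrow> 1 \<le> g p\<close>[OF that True] inner_self_disc[OF that]
      by (intro mult_left_mono) (auto simp: \<psi>_def)
    then show ?thesis
      by (simp add: g_def inner_prod_def algebra_simps)
  qed (simp add: \<psi>_def max_def inner_prod_def)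
  define D where "D = divergence (\<lambda>p. \<psi> p * fst p) (\<lambda>p. \<psi> p * snd p)"
  note radial = C_on_disc_mult[OF \<psi>1 C_on_disc_fst_snd(1)] C_on_disc_mult[OF \<psi>1 C_on_disc_fst_snd(2)]
  have "integral disc (divergence (\<lambda>p. \<psi> p * a p) (\<lambda>p. \<psi> p * b p)) =
      integral disc (\<lambda>p. \<psi> p * divergence a b p)"
    using integral_divergence_mult[OF \<psi>1 a b] weak[OF \<psi>] by simp
  also have "\<dots> = integral disc (\<lambda>p. 0)"
    using divergence_eq_0_of_weak[OF a b weak] by (intro Henstock_Kurzweil_Integration.integral_cong) simp
  finally have "(\<lambda>n. shell_integral n (\<lambda>p. p \<bullet> (\<psi> p * a p, \<psi> p * b p))) \<longlonglongrightarrow> 0"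
    using shell_integral_flux_tendsto[OF C_on_disc_mult[OF \<psi>1 a] C_on_disc_mult[OF \<psi>1 b]] by simp
  then have "(\<lambda>n. shell_integral n (\<lambda>p. k * (p \<bullet> (\<psi> p * a p, \<psi> p * b p)))) \<longlonglongrightarrow> 0"
    unfolding shell_integral_cmult by (rule tendsto_mult_right_zero)
  moreover have "(\<lambda>n. shell_integral n (\<lambda>p. p \<bullet> (\<psi> p * fst p, \<psi> p * snd p))) \<longlonglongrightarrow> integral disc D"
    unfolding D_def by (rule shell_integral_flux_tendsto[OF radial])
  moreover have "shell_integral n (\<lambda>p. p \<bullet> (\<psi> p * fst p, \<psi> p * snd p))
      \<le> shell_integral n (\<lambda>p. k * (p \<bullet> (\<psi> p * a p, \<psi> p * b p)))" for n
    using C_on_disc_continuous[OF a] C_on_disc_continuous[OF b] C_on_disc_continuous[OF \<psi>]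
    by (intro shell_integral_mono lower continuous_intros)
  ultimately have "integral disc D \<le> 0"
    by (intro LIMSEQ_le) auto
  \<comment> \<open>The first term is \<psi> times the divergence 2 of the position field; the
    second is the radial derivative of \<psi>.\<close>
  have D: "D p = 2 * \<psi> p + 4 * max 0 (q p) ^ 3 * (p \<bullet> z)" if "p \<in> disc" for p
  proof -
    have "(q has_derivative (\<lambda>h. h \<bullet> z)) (at p within disc)"
      unfolding q_def by (auto intro!: derivative_eq_intros)
    moreover have "((\<lambda>x. max 0 x ^ 4) has_derivative (*) (4 * max 0 (q p) ^ 3)) (at (q p))"
      using has_real_derivative_positive_part_power[of 2 "q p"]
      by (simp add: has_field_derivative_def)
    ultimately have "(\<psi> has_derivative (\<lambda>h. 4 * max 0 (q p) ^ 3 * (h \<bullet> z))) (at p within disc)"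
      unfolding \<psi>_def by (rule has_derivative_compose)
    note \<psi>' = deriv_disc_eq[OF this that]
    have "divergence fst snd p = 2"
      by (rule divergence_fst_snd[OF that])
    moreover have "\<psi> differentiable_on disc" "fst differentiable_on disc" "snd differentiable_on disc"
      using C_on_disc_fst_snd[of 1] \<psi>1 by simp_all
    ultimately show ?thesis
      unfolding D_def by (simp only: divergence_mult that \<psi>') (simp add: inner_prod_def algebra_simps)
  qed
  have D_nonneg: "0 \<le> D p" if "p \<in> disc" for p
  proof (cases "q p > 0")
    case True
    then have "0 \<le> p \<bullet> z" using \<delta> by (simp add: q_def)
    then show ?thesis by (simp add: D[OF that] \<psi>_def)
  qed (simp add: D[OF that] \<psi>_def max_def)
  have D_cont: "continuous_on disc D"
    unfolding D_def by (rule divergence_continuous[OF radial])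
  have "0 \<le> integral disc D"
    using D_nonneg by (intro Henstock_Kurzweil_Integration.integral_nonneg integrable_disc_cont D_cont)
  with \<open>integral disc D \<le> 0\<close> have "D z = 0"
    using integral_disc_nonneg_eq_0D[OF D_cont D_nonneg _ \<open>z \<in> disc\<close>] by linarith
  moreover have "D z = 2 * \<delta> ^ 4 + 4 * \<delta> ^ 3"
    using \<delta>(1) D[OF \<open>z \<in> disc\<close>] \<open>z \<bullet> z = 1\<close> by (simp add: \<psi>_def q_def)
  moreover have "0 < \<delta> ^ 4" "0 < \<delta> ^ 3"
    using \<delta>(1) by simp_all
  ultimately show False
    by linarith
qed

text \<open>The forward direction is the two localisation arguments. Conversely,
  \<open>f (a, b)\<close> inherits the zero normal component, so integration by parts leaves no
  boundary term.\<close>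

lemma weak_Neumann_iff:
  assumes a: "C_on_disc 1 a" and b: "C_on_disc 1 b"
  shows "(\<forall>f. C_on_disc 3 f \<longrightarrow> integral disc (\<lambda>p. deriv_u f p * a p + deriv_v f p * b p) = 0) \<longleftrightarrow>
    (\<forall>p\<in>disc. divergence a b p = 0) \<and> (\<forall>p\<in>sphere 0 1. p \<bullet> (a p, b p) = 0)"
proof (intro iffI allI impI)
  assume "\<forall>f. C_on_disc 3 f \<longrightarrow> integral disc (\<lambda>p. deriv_u f p * a p + deriv_v f p * b p) = 0"
  then have weak: "integral disc (\<lambda>p. deriv_u f p * a p + deriv_v f p * b p) = 0" if "C_on_disc 3 f" for f
    using that by blast
  show "(\<forall>p\<in>disc. divergence a b p = 0) \<and> (\<forall>p\<in>sphere 0 1. p \<bullet> (a p, b p) = 0)"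
    by (intro conjI ballI divergence_eq_0_of_weak[OF a b weak] normal_component_eq_0_of_weak[OF a b weak])
next
  fix f :: "real \<times> real \<Rightarrow> real"
  assume *: "(\<forall>p\<in>disc. divergence a b p = 0) \<and> (\<forall>p\<in>sphere 0 1. p \<bullet> (a p, b p) = 0)"
    and "C_on_disc 3 f"
  then have f: "C_on_disc 1 f" by (metis C_on_disc_mono one_le_numeral)
  have "p \<bullet> (f p * a p, f p * b p) = f p * (p \<bullet> (a p, b p))" for p
    by (simp add: inner_prod_def algebra_simps)
  then have "integral disc (divergence (\<lambda>p. f p * a p) (\<lambda>p. f p * b p)) = 0"
    using * by (intro integral_divergence_eq_0 C_on_disc_mult f a b) simp
  moreover have "integral disc (\<lambda>p. f p * divergence a b p) = integral disc (\<lambda>p. 0)"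
    using * by (intro Henstock_Kurzweil_Integration.integral_cong) simp
  ultimately show "integral disc (\<lambda>p. deriv_u f p * a p + deriv_v f p * b p) = 0"
    using integral_divergence_mult[OF f a b] by simp
qed

section \<open>Torsion of rotated frames\<close>

lemma deriv_disc_inner:
  fixes f g :: "real \<times> real \<Rightarrow> 'a::real_inner"
  assumes "f differentiable_on disc" "g differentiable_on disc" "p \<in> disc"
  shows "deriv_u (\<lambda>p. f p \<bullet> g p) p = f p \<bullet> deriv_u g p + deriv_u f p \<bullet> g p"
    and "deriv_v (\<lambda>p. f p \<bullet> g p) p = f p \<bullet> deriv_v g p + deriv_v f p \<bullet> g p"
  using deriv_disc_eq[OF has_derivative_inner[OF differentiable_has_derivative_disc[OF assms(1,3)]
      differentiable_has_derivative_disc[OF assms(2,3)]] assms(3)] by simp_all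

lemma deriv_disc_const: "p \<in> disc \<Longrightarrow> deriv_u (\<lambda>_. c) p = 0" "p \<in> disc \<Longrightarrow> deriv_v (\<lambda>_. c) p = 0"
  using deriv_disc_eq[OF has_derivative_const, of p] by auto

lemma deriv_disc_add:
  assumes "f differentiable_on disc" "g differentiable_on disc" "p \<in> disc"
  shows "deriv_u (\<lambda>p. f p + g p) p = deriv_u f p + deriv_u g p"
    and "deriv_v (\<lambda>p. f p + g p) p = deriv_v f p + deriv_v g p"
  using deriv_disc_eq[OF has_derivative_add[OF differentiable_has_derivative_disc[OF assms(1,3)]
      differentiable_has_derivative_disc[OF assms(2,3)]] assms(3)] by simp_all

lemma deriv_disc_rotated_N1:
  assumes "\<phi> differentiable_on disc" "N1 differentiable_on disc" "N2 differentiable_on disc" "p \<in> disc"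
  shows "deriv_u (rotated_N1 \<phi> N1 N2) p =
      cos (\<phi> p) *\<^sub>R (deriv_u N1 p + deriv_u \<phi> p *\<^sub>R N2 p) + sin (\<phi> p) *\<^sub>R (deriv_u N2 p - deriv_u \<phi> p *\<^sub>R N1 p)"
    and "deriv_v (rotated_N1 \<phi> N1 N2) p =
      cos (\<phi> p) *\<^sub>R (deriv_v N1 p + deriv_v \<phi> p *\<^sub>R N2 p) + sin (\<phi> p) *\<^sub>R (deriv_v N2 p - deriv_v \<phi> p *\<^sub>R N1 p)"
proof -
  note D = differentiable_has_derivative_disc[OF assms(1,4)] differentiable_has_derivative_disc[OF assms(2,4)]
    differentiable_has_derivative_disc[OF assms(3,4)]
  note R = has_derivative_add[OF has_derivative_scaleR[OF has_derivative_cos[OF D(1)] D(2)]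
      has_derivative_scaleR[OF has_derivative_sin[OF D(1)] D(3)]]
  show "deriv_u (rotated_N1 \<phi> N1 N2) p =
      cos (\<phi> p) *\<^sub>R (deriv_u N1 p + deriv_u \<phi> p *\<^sub>R N2 p) + sin (\<phi> p) *\<^sub>R (deriv_u N2 p - deriv_u \<phi> p *\<^sub>R N1 p)"
    unfolding rotated_N1_def[abs_def] deriv_disc_eq(1)[OF R assms(4)] by (simp add: algebra_simps)
  show "deriv_v (rotated_N1 \<phi> N1 N2) p =
      cos (\<phi> p) *\<^sub>R (deriv_v N1 p + deriv_v \<phi> p *\<^sub>R N2 p) + sin (\<phi> p) *\<^sub>R (deriv_v N2 p - deriv_v \<phi> p *\<^sub>R N1 p)"
    unfolding rotated_N1_def[abs_def] deriv_disc_eq(2)[OF R assms(4)] by (simp add: algebra_simps)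
qed

text \<open>Isolates the conditions on the frame that do not involve \<open>X\<close>; the torsion
  computations need no others. Unit length is written with inner products so that it can be
  differentiated.\<close>

definition orthonormal_frame :: "(real \<times> real \<Rightarrow> real ^ 4) \<Rightarrow> (real \<times> real \<Rightarrow> real ^ 4) \<Rightarrow> bool"
  where "orthonormal_frame N1 N2 \<longleftrightarrow> C_on_disc 3 N1 \<and> C_on_disc 3 N2 \<and>
    (\<forall>p\<in>disc. N1 p \<bullet> N1 p = 1 \<and> N2 p \<bullet> N2 p = 1 \<and> N1 p \<bullet> N2 p = 0)"

lemma orthonormal_normal_section_iff:
  "orthonormal_normal_section X N1 N2 \<longleftrightarrow> orthonormal_frame N1 N2 \<and>
    (\<forall>p\<in>disc. deriv_u X p \<bullet> N1 p = 0 \<and> deriv_v X p \<bullet> N1 p = 0 \<and>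
              deriv_u X p \<bullet> N2 p = 0 \<and> deriv_v X p \<bullet> N2 p = 0)"
  unfolding orthonormal_normal_section_def orthonormal_frame_def norm_eq_1 by blast

text \<open>Pointwise algebra: \<open>d1\<close>, \<open>d2\<close> stand for a partial derivative
  of the two frame vectors and \<open>x\<close> for that of the angle. The last three hypotheses are
  the differentiated orthonormality relations.\<close>

lemma torsion_rotation_identity:
  fixes n1 n2 d1 d2 :: "'a::real_inner"
  assumes "n1 \<bullet> n1 = 1" "n2 \<bullet> n2 = 1" "n1 \<bullet> n2 = 0"
    and "n1 \<bullet> d1 = 0" "n2 \<bullet> d2 = 0" "n1 \<bullet> d2 + d1 \<bullet> n2 = 0"
  shows "(cos t *\<^sub>R (d1 + x *\<^sub>R n2) + sin t *\<^sub>R (d2 - x *\<^sub>R n1)) \<bullet> (- sin t *\<^sub>R n1 + cos t *\<^sub>R n2) = d1 \<bullet> n2 + x"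
proof -
  have "d1 \<bullet> n1 = 0" "d2 \<bullet> n2 = 0" "d2 \<bullet> n1 = - (d1 \<bullet> n2)" "n2 \<bullet> n1 = 0"
    using assms by (auto simp: inner_commute)
  \<comment> \<open>Generic \<open>s\<close> and \<open>c\<close> keep the computation polynomial;
    the Pythagorean identity enters only at the end.\<close>
  then have "(c *\<^sub>R (d1 + x *\<^sub>R n2) + s *\<^sub>R (d2 - x *\<^sub>R n1)) \<bullet> (- s *\<^sub>R n1 + c *\<^sub>R n2) =
      (s\<^sup>2 + c\<^sup>2) * (d1 \<bullet> n2 + x)" for s c
    using assms(1-3)
    by (simp add: inner_add_left inner_add_right inner_diff_left power2_eq_square algebra_simps)
  then show ?thesis by simp
qed

lemma torsion_rotated:
  assumes N: "orthonormal_frame N1 N2" and \<phi>: "\<phi> differentiable_on disc" and p: "p \<in> disc"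
  shows "torsion_u (rotated_N1 \<phi> N1 N2) (rotated_N2 \<phi> N1 N2) p = torsion_u N1 N2 p + deriv_u \<phi> p"
    and "torsion_v (rotated_N1 \<phi> N1 N2) (rotated_N2 \<phi> N1 N2) p = torsion_v N1 N2 p + deriv_v \<phi> p"
proof -
  have d: "N1 differentiable_on disc" "N2 differentiable_on disc"
    using N by (auto simp: orthonormal_frame_def intro: C_on_disc_differentiable)
  have on: "N1 q \<bullet> N1 q = 1" "N2 q \<bullet> N2 q = 1" "N1 q \<bullet> N2 q = 0" if "q \<in> disc" for q
    using N that unfolding orthonormal_frame_def by blast+
  have u: "N1 p \<bullet> deriv_u N1 p = 0" "N2 p \<bullet> deriv_u N2 p = 0" "N1 p \<bullet> deriv_u N2 p + deriv_u N1 p \<bullet> N2 p = 0"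
    and v: "N1 p \<bullet> deriv_v N1 p = 0" "N2 p \<bullet> deriv_v N2 p = 0" "N1 p \<bullet> deriv_v N2 p + deriv_v N1 p \<bullet> N2 p = 0"
    using deriv_disc_inner[OF d(1) d(1) p] deriv_disc_inner[OF d(2) d(2) p] deriv_disc_inner[OF d p]
      deriv_disc_cong[of "\<lambda>q. N1 q \<bullet> N1 q" "\<lambda>_. 1", OF on(1) p]
      deriv_disc_cong[of "\<lambda>q. N2 q \<bullet> N2 q" "\<lambda>_. 1", OF on(2) p]
      deriv_disc_cong[of "\<lambda>q. N1 q \<bullet> N2 q" "\<lambda>_. 0", OF on(3) p]
    by (simp_all add: deriv_disc_const[OF p] inner_commute)
  show "torsion_u (rotated_N1 \<phi> N1 N2) (rotated_N2 \<phi> N1 N2) p = torsion_u N1 N2 p + deriv_u \<phi> p"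
    unfolding torsion_u_def deriv_disc_rotated_N1[OF \<phi> d p] rotated_N2_def
    by (rule torsion_rotation_identity[OF on[OF p] u])
  show "torsion_v (rotated_N1 \<phi> N1 N2) (rotated_N2 \<phi> N1 N2) p = torsion_v N1 N2 p + deriv_v \<phi> p"
    unfolding torsion_v_def deriv_disc_rotated_N1[OF \<phi> d p] rotated_N2_def
    by (rule torsion_rotation_identity[OF on[OF p] v])
qed

lemma C_on_disc_torsion:
  assumes "orthonormal_frame N1 N2"
  shows "C_on_disc 2 (torsion_u N1 N2)" "C_on_disc 2 (torsion_v N1 N2)"
proof -
  have "C_on_disc 3 N1" "C_on_disc 2 N2"
    using assms C_on_disc_mono[of 3 N2 2] by (auto simp: orthonormal_frame_def)
  then show "C_on_disc 2 (torsion_u N1 N2)" "C_on_disc 2 (torsion_v N1 N2)"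
    unfolding torsion_u_def[abs_def] torsion_v_def[abs_def]
    by (auto intro!: C_on_disc_inner simp: numeral_3_eq_3 numeral_2_eq_2 simp del: C_on_disc.simps
        dest: C_on_disc.simps(2)[THEN iffD1])
qed

text \<open>Rotation by \<open>t f\<close> adds \<open>t\<close> times the gradient of
  \<open>f\<close> to the torsion field, so the total torsion is
  \<open>2 * (A + 2 * t * B + t\<^sup>2 * C)\<close>. The 4 combines its prefactor with the 2 of the
  cross term.\<close>

lemma total_torsion_variation:
  assumes N: "orthonormal_frame N1 N2" and f: "C_on_disc 3 f"
  shows "((\<lambda>t. total_torsion (rotated_N1 (\<lambda>p. t * f p) N1 N2) (rotated_N2 (\<lambda>p. t * f p) N1 N2))
    has_real_derivative
      4 * integral disc (\<lambda>p. deriv_u f p * torsion_u N1 N2 p + deriv_v f p * torsion_v N1 N2 p)) (at 0)"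
proof -
  let ?a = "torsion_u N1 N2" and ?b = "torsion_v N1 N2"
  define A where "A = integral disc (\<lambda>p. (?a p)\<^sup>2 + (?b p)\<^sup>2)"
  define B where "B = integral disc (\<lambda>p. deriv_u f p * ?a p + deriv_v f p * ?b p)"
  define C where "C = integral disc (\<lambda>p. (deriv_u f p)\<^sup>2 + (deriv_v f p)\<^sup>2)"
  have cont: "continuous_on disc ?a" "continuous_on disc ?b"
    "continuous_on disc (deriv_u f)" "continuous_on disc (deriv_v f)"
    using C_on_disc_torsion[OF N] f
    by (auto simp: numeral_3_eq_3 simp del: C_on_disc.simps intro: C_on_disc_continuous
        dest: C_on_disc.simps(2)[THEN iffD1])
  have df: "f differentiable_on disc"
    using f by (rule C_on_disc_differentiable) simp
  have "total_torsion (rotated_N1 (\<lambda>p. t * f p) N1 N2) (rotated_N2 (\<lambda>p. t * f p) N1 N2) =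
      2 * (A + 2 * t * B + t\<^sup>2 * C)" for t
  proof -
    have dt: "(\<lambda>_. t) differentiable_on disc" by simp
    have "(\<lambda>p. t * f p) differentiable_on disc"
      using C_on_disc_mult[OF C_on_disc_const f] by (rule C_on_disc_differentiable) simp
    note T = torsion_rotated[OF N this]
    have "integral disc (\<lambda>p. (torsion_u (rotated_N1 (\<lambda>p. t * f p) N1 N2) (rotated_N2 (\<lambda>p. t * f p) N1 N2) p)\<^sup>2 +
        (torsion_v (rotated_N1 (\<lambda>p. t * f p) N1 N2) (rotated_N2 (\<lambda>p. t * f p) N1 N2) p)\<^sup>2) =
      integral disc (\<lambda>p. ((?a p)\<^sup>2 + (?b p)\<^sup>2) + 2 * t * (deriv_u f p * ?a p + deriv_v f p * ?b p) +
        t\<^sup>2 * ((deriv_u f p)\<^sup>2 + (deriv_v f p)\<^sup>2))"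
    proof (rule Henstock_Kurzweil_Integration.integral_cong)
      fix p :: "real \<times> real" assume p: "p \<in> disc"
      show "(torsion_u (rotated_N1 (\<lambda>p. t * f p) N1 N2) (rotated_N2 (\<lambda>p. t * f p) N1 N2) p)\<^sup>2 +
        (torsion_v (rotated_N1 (\<lambda>p. t * f p) N1 N2) (rotated_N2 (\<lambda>p. t * f p) N1 N2) p)\<^sup>2 =
        ((?a p)\<^sup>2 + (?b p)\<^sup>2) + 2 * t * (deriv_u f p * ?a p + deriv_v f p * ?b p) +
        t\<^sup>2 * ((deriv_u f p)\<^sup>2 + (deriv_v f p)\<^sup>2)"
        unfolding T[OF p] deriv_disc_mult[OF dt df p] deriv_disc_const[OF p]
        by (simp add: power2_eq_square algebra_simps)
    qed
    also have "\<dots> = A + 2 * t * B + t\<^sup>2 * C"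
      unfolding A_def B_def C_def Henstock_Kurzweil_Integration.integral_mult_right[symmetric]
      using cont
      by (simp add: Henstock_Kurzweil_Integration.integral_add integrable_disc_cont continuous_intros)
    finally show ?thesis by (simp add: total_torsion_def)
  qed
  moreover have "((\<lambda>t. 2 * (A + 2 * t * B + t\<^sup>2 * C)) has_real_derivative 4 * B) (at 0)"
    by (auto intro!: derivative_eq_intros)
  ultimately show ?thesis by (simp add: B_def)
qed

section \<open>Criticality as a Neumann problem\<close>

lemma critical_section_iff:
  assumes "orthonormal_normal_section X N1 N2"
  shows "critical_section X N1 N2 \<longleftrightarrow>
    (\<forall>p\<in>disc. divergence (torsion_u N1 N2) (torsion_v N1 N2) p = 0) \<and>
    (\<forall>p\<in>sphere 0 1. p \<bullet> (torsion_u N1 N2 p, torsion_v N1 N2 p) = 0)"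
proof -
  have N: "orthonormal_frame N1 N2"
    using assms by (simp add: orthonormal_normal_section_iff)
  \<comment> \<open>The variation is known to be differentiable, so by uniqueness of derivatives
    criticality only asks that its value be 0.\<close>
  have "(F has_real_derivative 0) (at 0) \<longleftrightarrow> D = 0"
    if "(F has_real_derivative 4 * D) (at 0)" for F D
    using that DERIV_unique by fastforce
  then have "critical_section X N1 N2 \<longleftrightarrow> (\<forall>f. C_on_disc 3 f \<longrightarrow>
      integral disc (\<lambda>p. deriv_u f p * torsion_u N1 N2 p + deriv_v f p * torsion_v N1 N2 p) = 0)"
    unfolding critical_section_def using total_torsion_variation[OF N] assms by blast
  also have "\<dots> \<longleftrightarrow> (\<forall>p\<in>disc. divergence (torsion_u N1 N2) (torsion_v N1 N2) p = 0) \<and>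
    (\<forall>p\<in>sphere 0 1. p \<bullet> (torsion_u N1 N2 p, torsion_v N1 N2 p) = 0)"
    using C_on_disc_torsion[OF N] by (intro weak_Neumann_iff) (auto elim: C_on_disc_mono simp del: C_on_disc.simps)
  finally show ?thesis .
qed

text \<open>The functions \<open>N1\<close>, \<open>N2\<close> enter only through the rotation
  formulas. Inverting the rotation expresses them through \<open>M1\<close>, \<open>M2\<close> and
  \<phi>, from which regularity, normality and orthonormality are inherited.\<close>

lemma orthonormal_normal_section_unrotate:
  assumes M: "orthonormal_normal_section X M1 M2" and \<phi>: "C_on_disc 3 \<phi>"
    and M1: "\<forall>p\<in>disc. M1 p = rotated_N1 \<phi> N1 N2 p"
    and M2: "\<forall>p\<in>disc. M2 p = rotated_N2 \<phi> N1 N2 p"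
  shows "orthonormal_normal_section X N1 N2"
proof -
  have sc: "(sin (\<phi> p))\<^sup>2 + (cos (\<phi> p))\<^sup>2 = 1" for p by simp
  have N1: "N1 p = cos (\<phi> p) *\<^sub>R M1 p - sin (\<phi> p) *\<^sub>R M2 p" if "p \<in> disc" for p
  proof -
    have "c *\<^sub>R (c *\<^sub>R N1 p + s *\<^sub>R N2 p) - s *\<^sub>R (- s *\<^sub>R N1 p + c *\<^sub>R N2 p) =
        (s\<^sup>2 + c\<^sup>2) *\<^sub>R N1 p" for s c :: real
      by (simp add: power2_eq_square algebra_simps)
    then show ?thesis
      unfolding M1[rule_format, OF that] M2[rule_format, OF that] rotated_N1_def rotated_N2_def by simp
  qed
  have N2: "N2 p = sin (\<phi> p) *\<^sub>R M1 p + cos (\<phi> p) *\<^sub>R M2 p" if "p \<in> disc" for p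
  proof -
    have "s *\<^sub>R (c *\<^sub>R N1 p + s *\<^sub>R N2 p) + c *\<^sub>R (- s *\<^sub>R N1 p + c *\<^sub>R N2 p) =
        (s\<^sup>2 + c\<^sup>2) *\<^sub>R N2 p" for s c :: real
      by (simp add: power2_eq_square algebra_simps)
    then show ?thesis
      unfolding M1[rule_format, OF that] M2[rule_format, OF that] rotated_N1_def rotated_N2_def by simp
  qed
  have MC: "C_on_disc 3 M1" "C_on_disc 3 M2"
    using M by (simp_all add: orthonormal_normal_section_def del: C_on_disc.simps)
  have "C_on_disc 3 (\<lambda>p. cos (\<phi> p) *\<^sub>R M1 p - sin (\<phi> p) *\<^sub>R M2 p)"
    "C_on_disc 3 (\<lambda>p. sin (\<phi> p) *\<^sub>R M1 p + cos (\<phi> p) *\<^sub>R M2 p)"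
    by (intro C_on_disc_add C_on_disc_diff C_on_disc_scaleR C_on_disc_sin C_on_disc_cos MC \<phi>)+
  then have "C_on_disc 3 N1" "C_on_disc 3 N2"
    by (simp_all only: C_on_disc_cong[of N1, OF N1] C_on_disc_cong[of N2, OF N2])
  moreover have "deriv_u X p \<bullet> N1 p = 0 \<and> deriv_v X p \<bullet> N1 p = 0 \<and>
      deriv_u X p \<bullet> N2 p = 0 \<and> deriv_v X p \<bullet> N2 p = 0 \<and>
      N1 p \<bullet> N1 p = 1 \<and> N2 p \<bullet> N2 p = 1 \<and> N1 p \<bullet> N2 p = 0" if p: "p \<in> disc" for p
  proof -
    have "deriv_u X p \<bullet> M1 p = 0" "deriv_v X p \<bullet> M1 p = 0" "deriv_u X p \<bullet> M2 p = 0" "deriv_v X p \<bullet> M2 p = 0"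
      "M1 p \<bullet> M1 p = 1" "M2 p \<bullet> M2 p = 1" "M1 p \<bullet> M2 p = 0"
      using M p unfolding orthonormal_normal_section_def norm_eq_1 by blast+
    then show ?thesis
      using sc[of p] unfolding N1[OF p] N2[OF p]
      by (simp add: inner_add_left inner_add_right inner_diff_left inner_diff_right
          inner_commute[of "M2 p" "M1 p"] power2_eq_square algebra_simps)
  qed
  ultimately show ?thesis
    unfolding orthonormal_normal_section_def norm_eq_1 by blast
qed

theorem mainTheorem3:
  fixes X :: "real \<times> real \<Rightarrow> real ^ 4"
    and M1 M2 N1 N2 :: "real \<times> real \<Rightarrow> real ^ 4"
    and \<phi> :: "real \<times> real \<Rightarrow> real"
  assumes "conformal_immersion X"
    and "orthonormal_normal_section X M1 M2"
    and "C_on_disc 3 \<phi>"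
    and "\<forall>p\<in>disc. M1 p = rotated_N1 \<phi> N1 N2 p"
    and "\<forall>p\<in>disc. M2 p = rotated_N2 \<phi> N1 N2 p"
  shows "critical_section X N1 N2 \<longleftrightarrow>
    (\<forall>p\<in>disc. laplacian \<phi> p = divergence (torsion_u M1 M2) (torsion_v M1 M2) p) \<and>
    (\<forall>p\<in>sphere 0 1. normal_deriv \<phi> p = (torsion_u M1 M2 p, torsion_v M1 M2 p) \<bullet> outer_normal p)"
proof -
  have N_section: "orthonormal_normal_section X N1 N2"
    by (rule orthonormal_normal_section_unrotate[OF assms(2-5)])
  then have N: "orthonormal_frame N1 N2"
    by (simp add: orthonormal_normal_section_iff)
  have \<phi>: "\<phi> differentiable_on disc" "C_on_disc 2 (deriv_u \<phi>)" "C_on_disc 2 (deriv_v \<phi>)"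
    using assms(3) by (simp_all add: numeral_3_eq_3 numeral_2_eq_2)
  have d\<phi>: "deriv_u \<phi> differentiable_on disc" "deriv_v \<phi> differentiable_on disc"
    using \<phi>(2,3) by (auto intro: C_on_disc_differentiable)
  have dT: "torsion_u N1 N2 differentiable_on disc" "torsion_v N1 N2 differentiable_on disc"
    using C_on_disc_torsion[OF N] by (auto intro: C_on_disc_differentiable)
  have T: "torsion_u M1 M2 p = torsion_u N1 N2 p + deriv_u \<phi> p"
    "torsion_v M1 M2 p = torsion_v N1 N2 p + deriv_v \<phi> p" if p: "p \<in> disc" for p
  proof -
    have "deriv_u M1 p = deriv_u (rotated_N1 \<phi> N1 N2) p" "deriv_v M1 p = deriv_v (rotated_N1 \<phi> N1 N2) p"
      using deriv_disc_cong[OF _ p, of M1 "rotated_N1 \<phi> N1 N2"] assms(4) by blast+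
    then show "torsion_u M1 M2 p = torsion_u N1 N2 p + deriv_u \<phi> p"
      "torsion_v M1 M2 p = torsion_v N1 N2 p + deriv_v \<phi> p"
      using torsion_rotated[OF N \<phi>(1) p] assms(5) p by (simp_all add: torsion_u_def torsion_v_def)
  qed
  \<comment> \<open>The Laplacian is the divergence of the gradient of \<phi>, which is exactly the
    difference of the two torsion fields.\<close>
  have "laplacian \<phi> p = divergence (torsion_u M1 M2) (torsion_v M1 M2) p \<longleftrightarrow>
      divergence (torsion_u N1 N2) (torsion_v N1 N2) p = 0" if p: "p \<in> disc" for p
  proof -
    have "deriv_u (torsion_u M1 M2) p = deriv_u (\<lambda>p. torsion_u N1 N2 p + deriv_u \<phi> p) p"
      by (rule deriv_disc_cong(1)[OF T(1) p])
    moreover have "deriv_v (torsion_v M1 M2) p = deriv_v (\<lambda>p. torsion_v N1 N2 p + deriv_v \<phi> p) p"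
      by (rule deriv_disc_cong(2)[OF T(2) p])
    ultimately show ?thesis
      unfolding laplacian_def divergence_def
      using deriv_disc_add(1)[OF dT(1) d\<phi>(1) p] deriv_disc_add(2)[OF dT(2) d\<phi>(2) p] by linarith
  qed
  moreover have "normal_deriv \<phi> p = (torsion_u M1 M2 p, torsion_v M1 M2 p) \<bullet> outer_normal p \<longleftrightarrow>
      p \<bullet> (torsion_u N1 N2 p, torsion_v N1 N2 p) = 0" if "p \<in> sphere 0 1" for p
  proof -
    have p: "p \<in> disc" using that by simp
    show ?thesis
      unfolding normal_deriv_eq[OF \<phi>(1) p] T[OF p] outer_normal_def
      by (simp add: inner_prod_def algebra_simps)
  qed
  ultimately show ?thesis
    unfolding critical_section_iff[OF N_section] by blast
qed

end
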